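(* Let $G$ be a planar graph that contains no $3$-cycles and no intersecting $4$-cycles. Let $L$ be a $6$-assignment for $G$ and let $\alpha$ and $\beta$ be $L$-colorings of $G$. Then there exists an $L$-recoloring sequence that transforms $\alpha$ into $\beta$ such that each vertex of $G$ is recolored at most $48$ times.
   Context: Graphs are finite and simple. A $k$-assignment $L$ for $G$ assigns to each vertex $v$ a list $L(v)$ of $k$ colors. An $L$-coloring is a proper coloring of $G$ in which each vertex $v$ receives a color from $L(v)$. An $L$-recoloring sequence transforming $\alpha$ into $\beta$ is a finite sequence of (proper) $L$-colorings of $G$ starting at $\alpha$ and ending at $\beta$ such that consecutive colorings differ at exactly one vertex; that vertex is said to be recolored at that step. "No intersecting $4$-cycles" means that no two distinct $4$-cycles of $G$ share a vertex. *)

theory Defs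
  imports "HOL-Analysis.Analysis" "Graph_Theory.Graph_Theory"
begin

text \<open>
  A finite simple graph is a \<open>pair_graph\<close>: a finite, loop-free, symmetric set of arcs
  without parallel arcs, so each undirected edge is present as two opposite arcs.
\<close>

text \<open>
  A drawing in the plane: \<open>pos\<close> places the vertices at distinct points and \<open>crv\<close> draws each edge
  as an injective continuous curve between its ends, passing through no other vertex. Opposite
  arcs are drawn as the same curve, and distinct edges meet only in vertices (hence, by the
  condition on vertices, only in common ends).
\<close>
definition plane_drawing ::
  "'a pair_pre_digraph \<Rightarrow> ('a \<Rightarrow> complex) \<Rightarrow> ('a \<times> 'a \<Rightarrow> real \<Rightarrow> complex) \<Rightarrow> bool" where
  "plane_drawing G pos crv \<longleftrightarrow>
     inj_on pos (pverts G) \<and>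
     (\<forall>(u, v) \<in> parcs G.
        arc (crv (u, v)) \<and>
        pathstart (crv (u, v)) = pos u \<and> pathfinish (crv (u, v)) = pos v \<and>
        path_image (crv (u, v)) \<inter> pos ` pverts G = {pos u, pos v} \<and>
        crv (v, u) = reversepath (crv (u, v))) \<and>
     (\<forall>(u, v) \<in> parcs G. \<forall>(x, y) \<in> parcs G. {u, v} \<noteq> {x, y} \<longrightarrow>
        path_image (crv (u, v)) \<inter> path_image (crv (x, y)) \<subseteq> pos ` pverts G)"

definition planar_graph :: "'a pair_pre_digraph \<Rightarrow> bool" where
  "planar_graph G \<longleftrightarrow> (\<exists>pos crv. plane_drawing G pos crv)"

text \<open>
  The library's \<open>cycle\<close> is a closed arc walk with distinct vertices; for length at least 3 this is
  a cycle of the undirected graph together with a starting point and an orientation. The cycle as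
  a subgraph is determined by its set of undirected edges.
\<close>
definition k_cycle :: "nat \<Rightarrow> 'a pair_pre_digraph \<Rightarrow> ('a \<times> 'a) list \<Rightarrow> bool" where
  "k_cycle k G p \<longleftrightarrow> pre_digraph.cycle (with_proj G) p \<and> length p = k"

definition cycle_verts :: "('a \<times> 'a) list \<Rightarrow> 'a set" where
  "cycle_verts p = fst ` set p"

definition cycle_edges :: "('a \<times> 'a) list \<Rightarrow> 'a set set" where
  "cycle_edges p = (\<lambda>(u, v). {u, v}) ` set p"

definition no_3_cycles :: "'a pair_pre_digraph \<Rightarrow> bool" where
  "no_3_cycles G \<longleftrightarrow> \<not> (\<exists>p. k_cycle 3 G p)"

definition no_intersecting_4_cycles :: "'a pair_pre_digraph \<Rightarrow> bool" where
  "no_intersecting_4_cycles G \<longleftrightarrow>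
     (\<forall>p q. k_cycle 4 G p \<longrightarrow> k_cycle 4 G q \<longrightarrow> cycle_edges p \<noteq> cycle_edges q \<longrightarrow>
        cycle_verts p \<inter> cycle_verts q = {})"

definition list_assignment :: "nat \<Rightarrow> 'a pair_pre_digraph \<Rightarrow> ('a \<Rightarrow> 'c set) \<Rightarrow> bool" where
  "list_assignment k G L \<longleftrightarrow> (\<forall>v \<in> pverts G. finite (L v) \<and> card (L v) = k)"

text \<open>
  Colorings are extensional functions on the vertex set, so that equality of functions is equality
  of colorings.
\<close>
definition list_coloring :: "'a pair_pre_digraph \<Rightarrow> ('a \<Rightarrow> 'c set) \<Rightarrow> ('a \<Rightarrow> 'c) \<Rightarrow> bool" where
  "list_coloring G L f \<longleftrightarrow>
     f \<in> (\<Pi>\<^sub>E v \<in> pverts G. L v) \<and> (\<forall>(u, v) \<in> parcs G. f u \<noteq> f v)"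

definition recoloring_sequence ::
  "'a pair_pre_digraph \<Rightarrow> ('a \<Rightarrow> 'c set) \<Rightarrow> ('a \<Rightarrow> 'c) \<Rightarrow> ('a \<Rightarrow> 'c) \<Rightarrow> ('a \<Rightarrow> 'c) list \<Rightarrow> bool" where
  "recoloring_sequence G L \<alpha> \<beta> cs \<longleftrightarrow>
     cs \<noteq> [] \<and> hd cs = \<alpha> \<and> last cs = \<beta> \<and>
     (\<forall>f \<in> set cs. list_coloring G L f) \<and>
     (\<forall>i. Suc i < length cs \<longrightarrow> (\<exists>!v. v \<in> pverts G \<and> (cs ! i) v \<noteq> (cs ! Suc i) v))"

definition times_recolored :: "('a \<Rightarrow> 'c) list \<Rightarrow> 'a \<Rightarrow> nat" where
  "times_recolored cs v = card {i. Suc i < length cs \<and> (cs ! i) v \<noteq> (cs ! Suc i) v}"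

end

theory Submission
  imports Defs "HOL-Complex_Analysis.Winding_Numbers"
begin

text \<open>
  Only one consequence of planarity is needed: every nonempty subgraph has average degree less
  than \<open>7/2\<close>. If the 4-cycles are pairwise disjoint, there are at most \<open>n/4\<close> faces of length 4, all
  other faces have length at least 5, and Euler's formula gives the bound; it is applied to the two
  sides of a closed curve by repeatedly cutting along ears, and separable graphs are glued from
  smaller ones.

  For graphs that are sparse in this sense the vertices outside a suitable set \<open>R\<close> can be ordered so
  that each vertex has at most two earlier neighbours, at most one of them in \<open>R\<close>, except for an
  independent set of vertices of degree 3, placed last, none of which has a neighbour in \<open>R\<close>. A
  recoloring sequence of \<open>R\<close> extends along this order: a vertex with \<open>b\<close> earlier neighbours that are
  recolored \<open>t\<close> times in total has to move about \<open>t / (5 - b)\<close> times.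
\<close>

section \<open>Extending recoloring sequences\<close>

text \<open>Up to rounding, a vertex with two earlier neighbours can plan three colors ahead, which
  multiplies recoloring counts by 2/3; with three earlier neighbours it plans only two ahead, which
  multiplies them by 3/2. Average degree below 7/2 still permits minimum degree 3, so the bad factor
  cannot be avoided, and a chain of such steps would grow without bound. It is therefore allowed
  only as a last step, with inputs well below the final bound. The set \<open>R\<close> absorbs, by
  induction, whatever already costs 48; a vertex that sees \<open>R\<close> once and a cheap vertex
  once stays at 27, and three neighbours at 27 lead to 42. So 48 reproduces itself instead of
  growing.

  The value 7/2 comes from Euler's formula: faces of length at least 5 allow at most (5/3)n edges,
  each quadrilateral face admits another 1/3, and n/4 of them give (5/3 + 1/12)n = (7/4)n edges. The
  same 7 is the threshold of the charges: a vertex of degree 4 with three neighbours in the set to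
  be added and one outside counts 2 * 3 + 1 = 7.\<close>

fun run :: "('a \<Rightarrow> 'c) \<Rightarrow> ('a \<times> 'c) list \<Rightarrow> 'a \<Rightarrow> 'c" where
  "run f [] = f"
| "run f ((v, c) # ms) = run (f(v := c)) ms"

definition recolorings :: "('a \<times> 'c) list \<Rightarrow> 'a \<Rightarrow> nat" where
  "recolorings ms v = length (filter (\<lambda>m. fst m = v) ms)"

lemma recolorings_simps [simp]:
  "recolorings [] v = 0"
  "recolorings ((u, c) # ms) v = (if u = v then Suc (recolorings ms v) else recolorings ms v)"
  "recolorings (ms @ ms') v = recolorings ms v + recolorings ms' v"
  by (auto simp: recolorings_def)

lemma run_append: "run f (ms @ ms') = run (run f ms) ms'"
proof (induction ms arbitrary: f)
  case (Cons m ms)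
  then show ?case by (cases m) (simp only: append_Cons run.simps)
qed simp

lemma run_cong_at: "f v = g v \<Longrightarrow> run f ms v = run g ms v"
proof (induction ms arbitrary: f g)
  case (Cons m ms)
  obtain u c where m: "m = (u, c)" by (cases m)
  have "run (f(u := c)) ms v = run (g(u := c)) ms v"
    using Cons.prems by (intro Cons.IH) simp
  then show ?case by (simp only: m run.simps)
qed simp

text \<open>This is why recolorings are kept as lists of moves: deleting the moves of
  \<open>v\<close> restricts a recoloring to the graph without \<open>v\<close>, and extending one
  means inserting moves of \<open>v\<close>.\<close>

lemma run_filter: "u \<noteq> v \<Longrightarrow> run f (filter (\<lambda>m. fst m \<noteq> v) ms) u = run f ms u"
proof (induction ms arbitrary: f)
  case (Cons m ms)
  obtain w c where m: "m = (w, c)" by (cases m)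
  let ?ms = "filter (\<lambda>m. fst m \<noteq> v) ms"
  have IH: "run (f(w := c)) ?ms u = run (f(w := c)) ms u"
    using Cons.prems by (rule Cons.IH)
  show ?case
  proof (cases "w = v")
    case True
    then have "run f ?ms u = run (f(w := c)) ?ms u"
      using Cons.prems by (intro run_cong_at) simp
    then show ?thesis using IH True by (simp add: m)
  next
    case False
    then show ?thesis using IH by (simp add: m)
  qed
qed simp

lemma recolorings_filter: "u \<noteq> v \<Longrightarrow> recolorings (filter (\<lambda>m. fst m \<noteq> v) ms) u = recolorings ms u"
  by (induction ms) auto

lemma sum_recolorings:
  "finite N \<Longrightarrow> length (filter (\<lambda>m. fst m \<in> N) ms) = (\<Sum>u\<in>N. recolorings ms u)"
proof (induction ms)
  case (Cons m ms)
  obtain u c where m: "m = (u, c)" by (cases m)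
  have "(\<Sum>x\<in>N. recolorings (m # ms) x)
      = (\<Sum>x\<in>N. recolorings ms x + (if u = x then 1 else 0))"
    by (rule sum.cong) (auto simp: m)
  also have "\<dots> = (\<Sum>x\<in>N. recolorings ms x) + (if u \<in> N then 1 else 0)"
    using Cons.prems by (simp add: sum.distrib)
  finally show ?case using Cons by (simp add: m)
qed simp

locale sym_graph =
  fixes E :: "('a \<times> 'a) set"
  assumes E_sym: "(u, v) \<in> E \<Longrightarrow> (v, u) \<in> E"
    and E_irrefl: "(v, v) \<notin> E"
begin

definition nbrs :: "'a set \<Rightarrow> 'a \<Rightarrow> 'a set" where
  "nbrs V v = {u \<in> V. (v, u) \<in> E}"

definition arcs_in :: "'a set \<Rightarrow> nat" where
  "arcs_in V = card (E \<inter> V \<times> V)"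

lemma finite_nbrs [simp]: "finite V \<Longrightarrow> finite (nbrs V v)"
  by (simp add: nbrs_def)

end

locale list_graph = sym_graph E for E :: "('a \<times> 'a) set" +
  fixes L :: "'a \<Rightarrow> 'c set"
begin

text \<open>Values outside \<open>V\<close> are left free, unlike in \<open>list_coloring\<close>,
  so one function serves as a coloring of every smaller vertex set too.\<close>

definition coloring :: "'a set \<Rightarrow> ('a \<Rightarrow> 'c) \<Rightarrow> bool" where
  "coloring V f \<longleftrightarrow> (\<forall>v\<in>V. f v \<in> L v) \<and> (\<forall>u\<in>V. \<forall>v\<in>V. (u, v) \<in> E \<longrightarrow> f u \<noteq> f v)"

fun valid :: "'a set \<Rightarrow> ('a \<Rightarrow> 'c) \<Rightarrow> ('a \<times> 'c) list \<Rightarrow> bool" where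
  "valid V f [] \<longleftrightarrow> coloring V f"
| "valid V f ((v, c) # ms) \<longleftrightarrow> coloring V f \<and> v \<in> V \<and> c \<noteq> f v \<and> valid V (f(v := c)) ms"

lemma valid_coloring: "valid V f ms \<Longrightarrow> coloring V f"
  by (cases ms) auto

lemma valid_coloring_run: "valid V f ms \<Longrightarrow> coloring V (run f ms)"
  by (induction V f ms rule: valid.induct) auto

lemma valid_append: "valid V f (ms @ ms') \<longleftrightarrow> valid V f ms \<and> valid V (run f ms) ms'"
proof (induction ms arbitrary: f)
  case (Cons m ms)
  then show ?case by (cases m) (simp only: append_Cons valid.simps run.simps, blast)
qed (auto intro: valid_coloring)

lemma coloring_cong: "(\<And>v. v \<in> V \<Longrightarrow> f v = g v) \<Longrightarrow> coloring V f = coloring V g"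
  by (auto simp: coloring_def)

lemma valid_cong: "(\<And>v. v \<in> V \<Longrightarrow> f v = g v) \<Longrightarrow> valid V f ms = valid V g ms"
proof (induction ms arbitrary: f g)
  case Nil
  then show ?case using coloring_cong[of V f g] by simp
next
  case (Cons m ms)
  obtain u c where m: "m = (u, c)" by (cases m)
  have "valid V (f(u := c)) ms = valid V (g(u := c)) ms"
    using Cons.prems by (intro Cons.IH) auto
  moreover have "coloring V f = coloring V g"
    using Cons.prems by (rule coloring_cong)
  ultimately show ?case using Cons.prems by (auto simp: m)
qed

lemma coloring_insert:
  "coloring (insert v V) f \<longleftrightarrow> coloring V f \<and> f v \<in> L v \<and> f v \<notin> f ` nbrs V v"
proof -
  have "(\<forall>u\<in>V. (u, v) \<in> E \<longrightarrow> f u \<noteq> f v) \<and> (\<forall>u\<in>V. (v, u) \<in> E \<longrightarrow> f v \<noteq> f u)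
      \<longleftrightarrow> f v \<notin> f ` nbrs V v"
  proof -
    have sym: "(u, v) \<in> E \<longleftrightarrow> (v, u) \<in> E" for u using E_sym by blast
    show ?thesis unfolding nbrs_def sym image_iff by (metis (mono_tags, lifting) mem_Collect_eq)
  qed
  then show ?thesis
    unfolding coloring_def using E_irrefl[of v] by simp blast
qed

definition recolorable :: "'a set \<Rightarrow> ('a \<Rightarrow> nat) \<Rightarrow> bool" where
  "recolorable V r \<longleftrightarrow> (\<forall>\<alpha> \<beta>. coloring V \<alpha> \<longrightarrow> coloring V \<beta> \<longrightarrow>
     (\<exists>ms. valid V \<alpha> ms \<and> (\<forall>v\<in>V. run \<alpha> ms v = \<beta> v) \<and> (\<forall>v\<in>V. recolorings ms v \<le> r v)))"

lemma recolorable_mono: "recolorable V r \<Longrightarrow> (\<And>v. v \<in> V \<Longrightarrow> r v \<le> s v) \<Longrightarrow> recolorable V s"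
  unfolding recolorable_def by (meson order_trans)

text \<open>
  Whenever a neighbour is about to take the color of \<open>v\<close>, move \<open>v\<close> to a color avoiding the at most
  \<open>b\<close> colors on its neighbours and the next \<open>D\<close> colors that its neighbours will receive. The
  parameter \<open>j\<close> counts how many of the upcoming colors are already known to be harmless.
\<close>
lemma lazy_extension:
  assumes "finite V" "v \<notin> V" "card (nbrs V v) + D < card (L v)" "D \<ge> 1"
    and "valid V f ms" "coloring (insert v V) f"
    and "f v \<notin> set (take j (map snd (filter (\<lambda>m. fst m \<in> nbrs V v) ms)))" "j \<le> D"
  shows "\<exists>ms'. valid (insert v V) f ms' \<and> filter (\<lambda>m. fst m \<noteq> v) ms' = ms \<and>
    D * recolorings ms' v \<le> (length (filter (\<lambda>m. fst m \<in> nbrs V v) ms) - j) + D - 1"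
  using assms(5-)
proof (induction ms arbitrary: f j)
  case Nil
  then show ?case using assms(4) by (intro exI[of _ "[]"]) auto
next
  case (Cons m ms)
  obtain u c where m: "m = (u, c)" by (cases m)
  let ?N = "nbrs V v"
  let ?t = "filter (\<lambda>m. fst m \<in> ?N) ms"
  have u: "u \<in> V" "u \<noteq> v" "c \<noteq> f u" and vld: "valid V (f(u := c)) ms"
    using Cons.prems assms(2) by (auto simp: m)
  have col: "coloring V (f(u := c))" using vld by (rule valid_coloring)
  have vN: "v \<notin> ?N" using assms(2) by (auto simp: nbrs_def)
  consider "u \<notin> ?N" | "u \<in> ?N" "c \<noteq> f v" | "u \<in> ?N" "c = f v" by blast
  then show ?case
  proof cases
    case 1
    have col': "coloring (insert v V) (f(u := c))"
      using 1 u(2) col Cons.prems(2) by (simp add: coloring_insert nbrs_def image_iff)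
    have t: "filter (\<lambda>m. fst m \<in> ?N) (m # ms) = ?t" using 1 by (simp add: m)
    have "(f(u := c)) v \<notin> set (take j (map snd ?t))"
      using Cons.prems(3) u(2) unfolding t by simp
    from Cons.IH[OF vld col' this Cons.prems(4)]
    obtain ms' where ms': "valid (insert v V) (f(u := c)) ms'" "filter (\<lambda>m. fst m \<noteq> v) ms' = ms"
      "D * recolorings ms' v \<le> (length ?t - j) + D - 1" by blast
    show ?thesis
      unfolding t using u ms' Cons.prems(2) by (intro exI[of _ "(u, c) # ms'"]) (simp add: m)
  next
    case 2
    have col': "coloring (insert v V) (f(u := c))"
      using 2 u(2) col Cons.prems(2) by (simp add: coloring_insert nbrs_def image_iff)
    have t: "filter (\<lambda>m. fst m \<in> ?N) (m # ms) = (u, c) # ?t" using 2 by (simp add: m)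
    have "(f(u := c)) v \<notin> set (take (j - 1) (map snd ?t))"
      using Cons.prems(3) u(2) unfolding t by (cases j) simp_all
    moreover have "j - 1 \<le> D" using Cons.prems(4) by simp
    ultimately obtain ms' where ms': "valid (insert v V) (f(u := c)) ms'" "filter (\<lambda>m. fst m \<noteq> v) ms' = ms"
      "D * recolorings ms' v \<le> (length ?t - (j - 1)) + D - 1"
      using Cons.IH[OF vld col'] by blast
    have "D * recolorings ms' v \<le> (length ((u, c) # ?t) - j) + D - 1"
      using ms'(3) by (cases j) simp_all
    then show ?thesis
      unfolding t using u ms' Cons.prems(2) by (intro exI[of _ "(u, c) # ms'"]) (simp add: m)
  next
    case 3
    then have j: "j = 0" using Cons.prems(3) by (cases j) (auto simp: m)
    \<comment> \<open>The first of the \<open>D\<close> avoided future colors is \<open>c\<close>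
      itself, which is also the present color of \<open>v\<close>. Once \<open>u\<close> has taken
      it, \<open>D - 1\<close> colors known to be harmless remain; this is the next value of
      \<open>j\<close>. As \<open>v\<close> moves before \<open>u\<close>, the old color of
      \<open>u\<close> has to be avoided as well.\<close>
    let ?bad = "f ` ?N \<union> set (take D (c # map snd ?t))"
    have "card ?bad \<le> card (f ` ?N) + card (set (take D (c # map snd ?t)))"
      by (rule card_Un_le)
    also have "\<dots> \<le> card ?N + D"
      using assms(1) by (intro add_mono card_image_le card_length[THEN order_trans]) auto
    finally have "card ?bad < card (L v)" using assms(3) by linarith
    moreover have "finite ?bad" using assms(1) by auto
    ultimately obtain c' where c': "c' \<in> L v" "c' \<notin> ?bad"
      by (meson card_mono leD subsetI)
    have c'c: "c' \<noteq> c" using c'(2) assms(4) by (cases D) auto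
    let ?g = "f(v := c')"
    have img: "?g ` ?N = f ` ?N" using vN by (intro image_cong) auto
    have colV: "coloring V f" using Cons.prems(2) by (simp add: coloring_insert)
    have colg: "coloring V ?g" using colV assms(2) coloring_cong[of V ?g f] by (metis fun_upd_other)
    then have c1: "coloring (insert v V) ?g" using c' img by (auto simp: coloring_insert)
    have "\<And>w. w \<in> V \<Longrightarrow> (?g(u := c)) w = (f(u := c)) w" using assms(2) by auto
    then have vld2: "valid V (?g(u := c)) ms" using vld valid_cong[of V "?g(u := c)" "f(u := c)"] by blast
    then have "coloring V (?g(u := c))" by (rule valid_coloring)
    moreover have "(?g(u := c)) ` ?N \<subseteq> insert c (f ` ?N)" using vN by auto
    ultimately have c2: "coloring (insert v V) (?g(u := c))"
      using c' c'c u by (auto simp: coloring_insert)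
    have new: "(?g(u := c)) v \<notin> set (take (D - 1) (map snd ?t))"
      using c'(2) assms(4) u by (cases D) auto
    from Cons.IH[OF vld2 c2 new diff_le_self]
    obtain ms' where ms': "valid (insert v V) (?g(u := c)) ms'"
      "filter (\<lambda>m. fst m \<noteq> v) ms' = ms"
      "D * recolorings ms' v \<le> (length ?t - (D - 1)) + D - 1"
      by blast
    \<comment> \<open>The claim is (t - j) / \<open>D\<close> rounded up, multiplied out, with t the
      number of upcoming moves of neighbours. The move of \<open>v\<close> is paid for by the move
      that triggers it and the \<open>D - 1\<close> following ones; if fewer follow, truncated
      subtraction leaves no room for another move.\<close>
    have "D * Suc (recolorings ms' v) \<le> Suc (length ?t) + D - 1"
    proof (cases "length ?t \<ge> D - 1")
      case True
      then show ?thesis using ms'(3) assms(4) by simp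
    next
      case False
      then have "D * recolorings ms' v < D * 1" using ms'(3) assms(4) by linarith
      then have "recolorings ms' v = 0" by (simp only: mult_less_cancel1) simp
      then show ?thesis by simp
    qed
    moreover have "valid (insert v V) f ((v, c') # (u, c) # ms')"
      using c1 ms'(1) u Cons.prems(2) c'c 3(2) by (simp del: fun_upd_apply add: fun_upd_other)
    moreover have "filter (\<lambda>m. fst m \<noteq> v) ((v, c') # (u, c) # ms') = m # ms"
      using u(2) ms'(2) by (simp add: m)
    moreover have "recolorings ((v, c') # (u, c) # ms') v = Suc (recolorings ms' v)"
      using u(2) by simp
    moreover have "length (filter (\<lambda>m. fst m \<in> ?N) (m # ms)) - j = Suc (length ?t)"
      using 3(1) by (simp add: m j)
    ultimately show ?thesis by metis
  qed
qed

text \<open>The last hypothesis makes \<open>q\<close> at least the neighbours' total divided by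
  \<open>D\<close>, rounded up, which covers all forced moves. The additional 1 is a final move of
  \<open>v\<close> to its target color, made when every other vertex has reached its own, so that it
  cannot conflict.\<close>

lemma recolorable_insert:
  assumes "finite V" "v \<notin> V" "card (nbrs V v) + D < card (L v)" "D \<ge> 1" "recolorable V r"
    and "(\<Sum>u\<in>nbrs V v. r u) + D \<le> D * q + 1"
  shows "recolorable (insert v V) (r(v := q + 1))"
  unfolding recolorable_def
proof (intro allI impI)
  fix \<alpha> \<beta> assume col: "coloring (insert v V) \<alpha>" "coloring (insert v V) \<beta>"
  let ?N = "nbrs V v"
  have "coloring V \<alpha>" "coloring V \<beta>" using col by (auto simp: coloring_insert)
  then obtain ms where ms: "valid V \<alpha> ms" "\<forall>v\<in>V. run \<alpha> ms v = \<beta> v" "\<forall>v\<in>V. recolorings ms v \<le> r v"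
    using assms(5) unfolding recolorable_def by blast
  from lazy_extension[OF assms(1-4) ms(1) col(1), of 0]
  obtain ms' where ms': "valid (insert v V) \<alpha> ms'" "filter (\<lambda>m. fst m \<noteq> v) ms' = ms"
    "D * recolorings ms' v \<le> length (filter (\<lambda>m. fst m \<in> ?N) ms) + D - 1" by auto
  have "length (filter (\<lambda>m. fst m \<in> ?N) ms) = (\<Sum>u\<in>?N. recolorings ms u)"
    using assms(1) by (intro sum_recolorings) simp
  also have "\<dots> \<le> (\<Sum>u\<in>?N. r u)"
    using ms(3) by (intro sum_mono) (auto simp: nbrs_def)
  finally have "D * recolorings ms' v \<le> D * q"
    using ms'(3) assms(4,6) by linarith
  then have q: "recolorings ms' v \<le> q" using assms(4) by simp
  have run': "run \<alpha> ms' u = \<beta> u" if "u \<in> V" for u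
    using run_filter[of u v \<alpha> ms'] that ms'(2) ms(2) assms(2) by metis
  have rec': "recolorings ms' u \<le> r u" if "u \<in> V" for u
    using recolorings_filter[of u v ms'] that ms'(2) ms(3) assms(2) by metis
  show "\<exists>ms. valid (insert v V) \<alpha> ms \<and> (\<forall>u\<in>insert v V. run \<alpha> ms u = \<beta> u) \<and>
      (\<forall>u\<in>insert v V. recolorings ms u \<le> (r(v := q + 1)) u)"
  proof (cases "run \<alpha> ms' v = \<beta> v")
    case True
    then show ?thesis using ms'(1) run' rec' q by (intro exI[of _ ms']) auto
  next
    case False
    let ?m = "ms' @ [(v, \<beta> v)]"
    have "\<And>u. u \<in> insert v V \<Longrightarrow> ((run \<alpha> ms')(v := \<beta> v)) u = \<beta> u" using run' by auto
    then have "coloring (insert v V) ((run \<alpha> ms')(v := \<beta> v))"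
      using col(2) coloring_cong[of "insert v V" "(run \<alpha> ms')(v := \<beta> v)" \<beta>] by blast
    then have "valid (insert v V) \<alpha> ?m"
      using ms'(1) False valid_coloring_run[OF ms'(1)] by (auto simp: valid_append)
    then show ?thesis
      using run' rec' q assms(2) by (intro exI[of _ ?m]) (auto simp: run_append)
  qed
qed

end

section \<open>Graphs of maximum average degree less than 7/2\<close>

context sym_graph
begin

lemma card_nbrs_Un:
  assumes "finite A" "finite B" "A \<inter> B = {}"
  shows "card (nbrs (A \<union> B) v) = card (nbrs A v) + card (nbrs B v)"
proof -
  have "nbrs (A \<union> B) v = nbrs A v \<union> nbrs B v" by (auto simp: nbrs_def)
  moreover have "nbrs A v \<inter> nbrs B v = {}" using assms(3) by (auto simp: nbrs_def)
  ultimately show ?thesis using assms by (simp add: card_Un_disjoint)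
qed

lemma nbrs_self [simp]: "nbrs {v} v = {}"
  using E_irrefl by (auto simp: nbrs_def)

lemma sum_card_nbrs_commute:
  assumes "finite A" "finite B"
  shows "(\<Sum>v\<in>A. card (nbrs B v)) = (\<Sum>v\<in>B. card (nbrs A v))"
proof -
  have "(\<Sum>v\<in>A. card (nbrs B v)) = card (SIGMA v:A. nbrs B v)"
    using assms by simp
  also have "\<dots> = card (SIGMA v:B. nbrs A v)"
  proof (rule bij_betw_same_card)
    show "bij_betw prod.swap (SIGMA v:A. nbrs B v) (SIGMA v:B. nbrs A v)"
    proof (rule bij_betwI[of _ _ _ prod.swap])
      show "prod.swap \<in> (SIGMA v:A. nbrs B v) \<rightarrow> (SIGMA v:B. nbrs A v)"
        unfolding nbrs_def by (auto, erule E_sym)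
      show "prod.swap \<in> (SIGMA v:B. nbrs A v) \<rightarrow> (SIGMA v:A. nbrs B v)"
        unfolding nbrs_def by (auto, erule E_sym)
    qed auto
  qed
  also have "\<dots> = (\<Sum>v\<in>B. card (nbrs A v))"
    using assms by simp
  finally show ?thesis .
qed

lemma arcs_in_eq_sum: "finite V \<Longrightarrow> arcs_in V = (\<Sum>v\<in>V. card (nbrs V v))"
proof -
  assume "finite V"
  have "E \<inter> V \<times> V = (SIGMA v:V. nbrs V v)" by (auto simp: nbrs_def)
  then show ?thesis using \<open>finite V\<close> by (simp add: arcs_in_def)
qed

text \<open>
  Twice the charge of \<open>R\<close> when every vertex \<open>v\<close> starts with \<open>deg v - 7/2\<close> and every vertex of \<open>R\<close>
  sends \<open>1/2\<close> along each edge leaving \<open>R\<close>.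
\<close>
definition charge :: "'a set \<Rightarrow> 'a set \<Rightarrow> int" where
  "charge V R = (\<Sum>v\<in>R. 2 * int (card (nbrs R v)) + int (card (nbrs (V - R) v)) - 7)"

text \<open>An edge between \<open>R\<close> and \<open>Q\<close> contributes 1 as long as only its
  end in \<open>R\<close> belongs to the set, and 2 at either end afterwards. The gain of 3 is
  booked entirely at the end in \<open>Q\<close>, which explains the coefficient 3.\<close>

lemma charge_Un:
  assumes "finite V" "R \<subseteq> V" "Q \<subseteq> V" "R \<inter> Q = {}"
  shows "charge V (R \<union> Q) = charge V R +
    (\<Sum>v\<in>Q. 3 * int (card (nbrs R v)) + 2 * int (card (nbrs Q v)) + int (card (nbrs (V - R - Q) v)) - 7)"
proof -
  have fin: "finite R" "finite Q" using assms(1-3) by (auto intro: finite_subset)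
  let ?n = "\<lambda>A v. int (card (nbrs A v))"
  define W where "W = V - R - Q"
  have RQ: "?n (R \<union> Q) v = ?n R v + ?n Q v" for v
    using card_nbrs_Un[OF fin assms(4)] by simp
  have "V - R = Q \<union> W" "Q \<inter> W = {}" "finite W" using assms by (auto simp: W_def)
  then have VR: "?n (V - R) v = ?n Q v + ?n W v" for v
    using card_nbrs_Un[of Q W v] fin by simp
  have W: "V - (R \<union> Q) = W" by (auto simp: W_def)
  have "charge V (R \<union> Q) = (\<Sum>v\<in>R. 2 * (?n R v + ?n Q v) + ?n W v - 7)
      + (\<Sum>v\<in>Q. 2 * (?n R v + ?n Q v) + ?n W v - 7)"
    unfolding charge_def RQ W using fin assms(4) by (simp add: sum.union_disjoint)
  also have "(\<Sum>v\<in>R. 2 * (?n R v + ?n Q v) + ?n W v - 7) = charge V R + (\<Sum>v\<in>R. ?n Q v)"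
    unfolding charge_def VR sum.distrib[symmetric] by (rule sum.cong) auto
  also have "(\<Sum>v\<in>R. ?n Q v) = (\<Sum>v\<in>Q. ?n R v)"
    using sum_card_nbrs_commute[OF fin] by (simp flip: of_nat_sum)
  also have "charge V R + (\<Sum>v\<in>Q. ?n R v) + (\<Sum>v\<in>Q. 2 * (?n R v + ?n Q v) + ?n W v - 7) =
      charge V R + (\<Sum>v\<in>Q. ?n R v + (2 * (?n R v + ?n Q v) + ?n W v - 7))"
    by (simp only: sum.distrib add.assoc)
  also have "(\<Sum>v\<in>Q. ?n R v + (2 * (?n R v + ?n Q v) + ?n W v - 7)) =
      (\<Sum>v\<in>Q. 3 * ?n R v + 2 * ?n Q v + ?n W v - 7)"
    by (rule sum.cong) auto
  finally show ?thesis by (simp add: W_def)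
qed

lemma charge_self: "finite V \<Longrightarrow> charge V V = 2 * int (arcs_in V) - 7 * int (card V)"
proof -
  assume "finite V"
  have "nbrs {} v = {}" for v by (simp add: nbrs_def)
  then show ?thesis
    using \<open>finite V\<close> by (simp add: charge_def arcs_in_eq_sum sum_subtractf sum_distrib_left)
qed

lemma maximal_independent_subset:
  assumes "finite A"
  obtains Y where "Y \<subseteq> A" "\<forall>u\<in>Y. \<forall>v\<in>Y. (u, v) \<notin> E" "\<forall>v\<in>A - Y. \<exists>y\<in>Y. (v, y) \<in> E"
proof -
  define I where "I = {Y. Y \<subseteq> A \<and> (\<forall>u\<in>Y. \<forall>v\<in>Y. (u, v) \<notin> E)}"
  have "finite I" using assms by (auto simp: I_def)
  moreover have "{} \<in> I" by (simp add: I_def)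
  ultimately obtain Y where Y: "Y \<in> I" and max: "\<And>Z. Z \<in> I \<Longrightarrow> Y \<subseteq> Z \<Longrightarrow> Y = Z"
    using finite_has_maximal2[of I "{}"] by metis
  have Y': "Y \<subseteq> A" "\<forall>u\<in>Y. \<forall>v\<in>Y. (u, v) \<notin> E" using Y by (auto simp: I_def)
  have "\<exists>y\<in>Y. (v, y) \<in> E" if v: "v \<in> A - Y" for v
  proof (rule ccontr)
    assume no: "\<not> ?thesis"
    then have "(v, y) \<notin> E" "(y, v) \<notin> E" if "y \<in> Y" for y using that E_sym[of y v] by auto
    then have "insert v Y \<in> I" using Y' v E_irrefl by (simp add: I_def)
    then have "Y = insert v Y" by (rule max) blast
    then show False using v by blast
  qed
  then have "\<forall>v\<in>A - Y. \<exists>y\<in>Y. (v, y) \<in> E" by blast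
  with Y' show ?thesis by (rule that)
qed

end

context list_graph
begin

text \<open>
  Take \<open>R\<close> maximal with nonnegative charge, so \<open>R \<noteq> V\<close>; the vertices outside \<open>R\<close> then have at most
  one neighbour in \<open>R\<close>. Let \<open>Y\<close> be a maximal independent set of 3-vertices without neighbours in
  \<open>R\<close>. Maximality of \<open>R\<close> lets the rest \<open>T\<close> be added to \<open>R\<close> one vertex at a time with at most two
  earlier neighbours each, at most one of them in \<open>R\<close>; so 27 recolorings suffice on \<open>T\<close>
  (since \<open>(48 + 27) / 3 + 2 = 27\<close>), and the vertices of \<open>Y\<close>, added last, see only \<open>T\<close>.
\<close>
theorem sparse_recolorable:
  assumes "finite V" "\<And>v. v \<in> V \<Longrightarrow> card (L v) \<ge> 6"
    and "\<And>W. W \<subseteq> V \<Longrightarrow> W \<noteq> {} \<Longrightarrow> 2 * arcs_in W < 7 * card W"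
  shows "recolorable V (\<lambda>_. 48)"
  using assms
proof (induction V rule: finite_psubset_induct)
  case (psubset V)
  have six: "card (L v) \<ge> 6" if "v \<in> V" for v using psubset.prems(1) that .
  have IH: "recolorable W (\<lambda>_. 48)" if "W \<subset> V" for W
    using that psubset.prems by (intro psubset.IH) auto
  have fin: "finite W" if "W \<subseteq> V" for W using that psubset.hyps finite_subset by blast
  consider "V = {}" | v where "v \<in> V" "card (nbrs V v) \<le> 2"
    | "V \<noteq> {}" "\<forall>v\<in>V. \<not> card (nbrs V v) \<le> 2" by blast
  then show ?case
  proof cases
    case 1
    then show ?thesis by (auto simp: recolorable_def coloring_def intro!: exI[of _ "[]"])
  next
    case 2
    let ?W = "V - {v}"
    have N: "nbrs ?W v = nbrs V v" using E_irrefl by (auto simp: nbrs_def)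
    \<comment> \<open>Two neighbours are recolored at most 96 times in total, and 96 + 3 is at most
      3 * 33 + 1. Once this case is settled, all degrees are at least 3.\<close>
    have "recolorable (insert v ?W) ((\<lambda>_. 48)(v := 33 + 1))"
      using 2 psubset.prems(1)[of v] fin IH[of ?W]
      by (intro recolorable_insert[where D = 3]) (auto simp: N)
    then show ?thesis
      using 2 by (auto simp: insert_absorb elim: recolorable_mono)
  next
    case 3
    then have deg3: "card (nbrs V v) \<ge> 3" if "v \<in> V" for v using that by force
    let ?n = "\<lambda>A v. card (nbrs A v)"
    let ?C = "{R. R \<subseteq> V \<and> charge V R \<ge> 0}"
    have "finite ?C" using psubset.hyps by auto
    moreover have "{} \<in> ?C" by (simp add: charge_def)
    ultimately obtain R where R: "R \<in> ?C" "\<forall>S\<in>?C. R \<subseteq> S \<longrightarrow> R = S"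
      using finite_has_maximal2[of ?C "{}"] by metis
    have "charge V V < 0"
      using psubset.prems(2)[of V] 3(1) psubset.hyps by (simp add: charge_self)
    then have RV: "R \<subset> V" using R by auto
    \<comment> \<open>Maximality of \<open>R\<close> in usable form: a nonempty \<open>Q\<close>
      with nonnegative gain could be added to \<open>R\<close>.\<close>
    have neg: "(\<Sum>v\<in>Q. 3 * int (?n R v) + 2 * int (?n Q v) + int (?n (V - R - Q) v) - 7) < 0"
      if Q: "Q \<subseteq> V - R" "Q \<noteq> {}" for Q
    proof (rule ccontr)
      assume neg: "\<not> ?thesis"
      have "charge V R \<ge> 0" "R \<subseteq> V" "Q \<subseteq> V" "R \<inter> Q = {}" using R Q by auto
      then have "R \<union> Q \<in> ?C"
        using charge_Un[of V R Q] psubset.hyps neg by simp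
      then show False using R Q by blast
    qed
    have deg: "?n V v = ?n R v + ?n Q v + ?n (V - R - Q) v" if "Q \<subseteq> V - R" for Q v
    proof -
      have "V = (R \<union> Q) \<union> (V - R - Q)" using that RV by blast
      moreover have "?n ((R \<union> Q) \<union> (V - R - Q)) v = ?n (R \<union> Q) v + ?n (V - R - Q) v"
        using that RV fin by (intro card_nbrs_Un) auto
      moreover have "?n (R \<union> Q) v = ?n R v + ?n Q v"
        using that RV fin by (intro card_nbrs_Un) auto
      ultimately show ?thesis by metis
    qed
    have one: "?n R v \<le> 1" if v: "v \<in> V - R" for v
    proof -
      \<comment> \<open>With \<open>Q\<close> a single vertex the gain is its degree plus twice its
        number of neighbours in \<open>R\<close>, minus 7. As the degree is at least 3, two
        neighbours in \<open>R\<close> would already make it nonnegative.\<close>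
      have "3 * int (?n R v) + int (?n (V - R - {v}) v) - 7 < 0"
        using neg[of "{v}"] v by simp
      moreover have "?n V v = ?n R v + ?n (V - R - {v}) v"
        using deg[of "{v}" v] v by simp
      moreover have "?n V v \<ge> 3" using deg3 v by simp
      ultimately show ?thesis by linarith
    qed
    define A where "A = {v \<in> V - R. ?n V v = 3 \<and> nbrs R v = {}}"
    obtain Y where Y: "Y \<subseteq> A" "\<forall>u\<in>Y. \<forall>v\<in>Y. (u, v) \<notin> E" "\<forall>v\<in>A - Y. \<exists>y\<in>Y. (v, y) \<in> E"
      using maximal_independent_subset[of A] fin[of A] by (auto simp: A_def)
    define T where "T = V - R - Y"
    have no_core: "\<exists>v\<in>Q. ?n (R \<union> Q) v \<le> 2" if Q: "Q \<subseteq> T" "Q \<noteq> {}" for Q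
    proof (rule ccontr)
      assume "\<not> ?thesis"
      then have big: "?n (R \<union> Q) v \<ge> 3" if "v \<in> Q" for v using that by force
      have QV: "Q \<subseteq> V - R" using Q by (auto simp: T_def)
      \<comment> \<open>The summand is the degree of \<open>v\<close>, plus its neighbours in
        \<open>R \<union> Q\<close>, plus its neighbours in \<open>R\<close>, minus 7. With at least
        three neighbours in \<open>R \<union> Q\<close> it can be negative only if the degree is 3
        and none of them lies in \<open>R\<close>. Those are exactly the vertices of
        \<open>A\<close>; the ones left in \<open>T\<close> have a neighbour in \<open>Y\<close>,
        hence at most two in \<open>R \<union> Q\<close>.\<close>
      have "3 * int (?n R v) + 2 * int (?n Q v) + int (?n (V - R - Q) v) - 7 \<ge> 0" if v: "v \<in> Q" for v
      proof -
        have d: "?n V v = ?n R v + ?n Q v + ?n (V - R - Q) v" using deg[OF QV] .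
        have "?n (R \<union> Q) v = ?n R v + ?n Q v"
          using QV RV fin by (intro card_nbrs_Un) auto
        then have b: "?n R v + ?n Q v \<ge> 3" using big[OF v] by simp
        show ?thesis
        proof (cases "?n V v = 3 \<and> ?n R v = 0")
          case True
          then have "nbrs R v = {}" using fin RV by simp
          then have "v \<in> A - Y" using True v Q by (auto simp: A_def T_def)
          then obtain y where "y \<in> Y" "(v, y) \<in> E" using Y by blast
          then have "y \<in> nbrs (V - R - Q) v" using Q Y by (auto simp: nbrs_def T_def A_def)
          then have "?n (V - R - Q) v \<noteq> 0" using psubset.hyps by auto
          then show ?thesis using d b True by linarith
        next
          case False
          then show ?thesis using d b by linarith
        qed
      qed
      then have "(\<Sum>v\<in>Q. 3 * int (?n R v) + 2 * int (?n Q v) + int (?n (V - R - Q) v) - 7) \<ge> 0"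
        by (rule sum_nonneg)
      then show False using neg[OF QV Q(2)] by simp
    qed
    let ?r = "\<lambda>v. if v \<in> T then 27 else 48 :: nat"
    have T: "recolorable (R \<union> S) ?r" if "S \<subseteq> T" for S
    proof -
      have "finite S" using that fin by (auto simp: T_def)
      then show ?thesis using that
      proof (induction S rule: finite_psubset_induct)
        case (psubset S)
        show ?case
        proof (cases "S = {}")
          case True
          then show ?thesis using IH[OF RV] by (auto elim!: recolorable_mono simp: T_def)
        next
          case False
          \<comment> \<open>The order is built from its end: \<open>v\<close> becomes the last
            vertex of \<open>S\<close>, so its earlier neighbours are those in \<open>R\<close> and
            in the rest of \<open>S\<close>.\<close>
          then obtain v where v: "v \<in> S" "?n (R \<union> S) v \<le> 2" using no_core psubset.prems by blast
          let ?S = "S - {v}"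
          have fS: "finite R" "finite ?S" using fin RV psubset.hyps by auto
          have vT: "v \<in> T" "v \<in> V" "v \<notin> R" using v psubset.prems by (auto simp: T_def)
          have "nbrs (R \<union> S) v = nbrs (R \<union> ?S) v" using E_irrefl by (auto simp: nbrs_def)
          moreover have c: "?n (R \<union> ?S) v = ?n R v + ?n ?S v"
            using fS vT psubset.prems by (intro card_nbrs_Un) (auto simp: T_def)
          ultimately have c2: "?n R v + ?n ?S v \<le> 2" using v by simp
          have "nbrs (R \<union> ?S) v = nbrs R v \<union> nbrs ?S v" "nbrs R v \<inter> nbrs ?S v = {}"
            using psubset.prems by (auto simp: nbrs_def T_def)
          then have "(\<Sum>u\<in>nbrs (R \<union> ?S) v. ?r u) = (\<Sum>u\<in>nbrs R v. ?r u) + (\<Sum>u\<in>nbrs ?S v. ?r u)"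
            using fS by (simp add: sum.union_disjoint)
          also have "(\<Sum>u\<in>nbrs R v. ?r u) = (\<Sum>u\<in>nbrs R v. 48)"
            by (rule sum.cong) (auto simp: nbrs_def T_def)
          also have "(\<Sum>u\<in>nbrs ?S v. ?r u) = (\<Sum>u\<in>nbrs ?S v. 27)"
            using psubset.prems by (intro sum.cong) (auto simp: nbrs_def)
          finally have "(\<Sum>u\<in>nbrs (R \<union> ?S) v. ?r u) + 3 \<le> 3 * 26 + 1"
            using c2 one[of v] vT by simp
          then have "recolorable (insert v (R \<union> ?S)) (?r(v := 26 + 1))"
            using fS vT c c2 psubset.IH[of ?S] psubset.prems v six[of v]
            by (intro recolorable_insert[where D = 3]) (auto simp: T_def)
          moreover have "insert v (R \<union> ?S) = R \<union> S" using v by auto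
          ultimately show ?thesis using vT by (auto elim!: recolorable_mono)
        qed
      qed
    qed
    have "recolorable (R \<union> T \<union> S) ?r" if "S \<subseteq> Y" for S
    proof -
      have "finite S" using that fin[of A] Y(1) finite_subset[of S A] by (auto simp: A_def)
      then show ?thesis using that
      proof (induction S rule: finite_induct)
        case empty
        then show ?case using T[of T] by simp
      next
        case (insert y S)
        have y: "y \<in> Y" "y \<in> V" "y \<notin> R" "y \<notin> T" "?n V y = 3" "nbrs R y = {}"
          using insert.prems Y by (auto simp: A_def T_def)
        let ?W = "R \<union> T \<union> S"
        have W: "?W \<subseteq> V" using insert.prems Y RV by (auto simp: T_def A_def)
        have N: "nbrs ?W y \<subseteq> T" "nbrs ?W y \<subseteq> nbrs V y"
          using y insert.prems Y(2) W by (auto simp: nbrs_def)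
        then have c: "?n ?W y \<le> 3" using y card_mono[of "nbrs V y" "nbrs ?W y"] psubset.hyps by simp
        have "(\<Sum>u\<in>nbrs ?W y. ?r u) = (\<Sum>u\<in>nbrs ?W y. 27)"
          using N by (intro sum.cong) auto
        \<comment> \<open>All neighbours present lie in \<open>T\<close>, so they are recolored at
          most 3 * 27 = 81 times. Three neighbours and a list of size 6 leave look-ahead 2, and 81 +
          2 = 2 * 41 + 1 holds with equality.\<close>
        then have "(\<Sum>u\<in>nbrs ?W y. ?r u) + 2 \<le> 2 * 41 + 1" using c by simp
        then have "recolorable (insert y ?W) (?r(y := 41 + 1))"
          using insert y c W fin psubset.prems(1)[of y]
          by (intro recolorable_insert[where D = 2]) auto
        then show ?case using y by (auto elim!: recolorable_mono)
      qed
    qed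
    then have "recolorable (R \<union> T \<union> Y) ?r" by simp
    moreover have "R \<union> T \<union> Y = V" using RV Y by (auto simp: T_def A_def)
    ultimately show ?thesis by (auto elim!: recolorable_mono)
  qed
qed

end

section \<open>Plane graphs\<close>

lemma connected_inside_or_outside:
  fixes K :: "complex set"
  assumes "closed K" "topological_space_class.connected T" "T \<inter> K = {}"
  shows "T \<subseteq> inside K \<or> T \<subseteq> outside K"
proof -
  have "T \<subseteq> inside K \<union> outside K" using assms(3) by auto
  moreover from this have "inside K \<inter> T = {} \<or> outside K \<inter> T = {}"
    using connectedD[OF assms(2) open_inside[OF assms(1)] open_outside[OF assms(1)]] by simp
  ultimately show ?thesis by blast
qed

text \<open>
  If the third arc of a theta-curve does not run inside the closed curve formed by the first two,
  then one of these two runs inside the curve formed by the other two: the winding numbers of the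
  three closed curves around a point inside the first one add up to zero (with suitable
  orientations), so this point also lies inside one of the other two curves.
\<close>
lemma theta_curve_inside:
  fixes a b :: complex
  assumes g1: "arc g1" "pathstart g1 = a" "pathfinish g1 = b"
    and g2: "arc g2" "pathstart g2 = a" "pathfinish g2 = b"
    and g3: "arc g3" "pathstart g3 = a" "pathfinish g3 = b"
    and i12: "path_image g1 \<inter> path_image g2 = {a, b}"
    and i13: "path_image g1 \<inter> path_image g3 = {a, b}"
    and i23: "path_image g2 \<inter> path_image g3 = {a, b}"
    and out: "path_image g3 \<inter> inside (path_image g1 \<union> path_image g2) = {}"
  shows "inside (path_image g1 \<union> path_image g2) \<union> (path_image g2 - {a, b})
           \<subseteq> inside (path_image g1 \<union> path_image g3) \<or>
         inside (path_image g1 \<union> path_image g2) \<union> (path_image g1 - {a, b})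
           \<subseteq> inside (path_image g2 \<union> path_image g3)"
proof -
  \<comment> \<open>One common inner point suffices: the inside of the first curve is connected and
    avoids \<open>h3\<close>, so it does not meet the second curve and lies entirely inside it.
    Passing to closures brings along \<open>h2\<close>, which is part of the frontier.\<close>
  have step: "inside (path_image h1 \<union> path_image h2) \<union> (path_image h2 - {a, b})
      \<subseteq> inside (path_image h1 \<union> path_image h3)"
    if "arc h1" "pathstart h1 = a" "pathfinish h1 = b" "arc h2" "pathstart h2 = a" "pathfinish h2 = b"
      "arc h3" and h12: "path_image h1 \<inter> path_image h2 = {a, b}"
      and h23: "path_image h2 \<inter> path_image h3 = {a, b}"
      and h3: "path_image h3 \<inter> inside (path_image h1 \<union> path_image h2) = {}"
      and z: "z \<in> inside (path_image h1 \<union> path_image h2)"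
        "z \<in> inside (path_image h1 \<union> path_image h3)"
    for h1 h2 h3 :: "real \<Rightarrow> complex" and z
  proof -
    let ?c = "h1 +++ reversepath h2"
    have simp: "simple_path ?c" "pathfinish ?c = pathstart ?c"
      using that by (auto simp: simple_path_join_loop_eq arc_reversepath)
    have im: "path_image ?c = path_image h1 \<union> path_image h2"
      using that by (simp add: path_image_join)
    note J = Jordan_inside_outside[OF simp, unfolded im]
    have cl: "closed (path_image h1 \<union> path_image h3)"
      using that by (intro closed_Un closed_arc_image) auto
    have "inside (path_image h1 \<union> path_image h2) \<inter> (path_image h1 \<union> path_image h3) = {}"
      using h3 inside_no_overlap[of "path_image h1 \<union> path_image h2"] by blast
    moreover have "topological_space_class.connected (inside (path_image h1 \<union> path_image h2))"
      using J by simp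
    ultimately have "inside (path_image h1 \<union> path_image h2) \<subseteq> inside (path_image h1 \<union> path_image h3) \<or>
        inside (path_image h1 \<union> path_image h2) \<subseteq> outside (path_image h1 \<union> path_image h3)"
      using connected_inside_or_outside[OF cl] by simp
    then have sub: "inside (path_image h1 \<union> path_image h2) \<subseteq> inside (path_image h1 \<union> path_image h3)"
      using z inside_Int_outside[of "path_image h1 \<union> path_image h3"] by blast
    have "frontier (inside (path_image h1 \<union> path_image h2)) = path_image h1 \<union> path_image h2"
      using J by simp
    then have "path_image h2 \<subseteq> closure (inside (path_image h1 \<union> path_image h2))"
      unfolding frontier_def by blast
    also have "\<dots> \<subseteq> closure (inside (path_image h1 \<union> path_image h3))"
      using sub by (rule closure_mono)
    also have "\<dots> \<subseteq> (path_image h1 \<union> path_image h3) \<union> inside (path_image h1 \<union> path_image h3)"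
      using cl by (rule closure_inside_subset)
    finally show ?thesis using sub h12 h23 by blast
  qed
  have loop: "simple_path (h +++ reversepath h')"
      "path_image (h +++ reversepath h') = path_image h \<union> path_image h'"
    if "arc h" "arc h'" "pathstart h = a" "pathfinish h = b" "pathstart h' = a" "pathfinish h' = b"
      "path_image h \<inter> path_image h' = {a, b}" for h h' :: "real \<Rightarrow> complex"
    using that by (auto simp: simple_path_join_loop_eq arc_reversepath path_image_join)
  have wn: "winding_number (h +++ reversepath h') z = winding_number h z - winding_number h' z"
    if "arc h" "arc h'" "pathfinish h = b" "pathfinish h' = b" "z \<notin> path_image h" "z \<notin> path_image h'"
    for h h' :: "real \<Rightarrow> complex" and z
    using that by (simp add: winding_number_join winding_number_reversepath arc_imp_path)
  have zero: "winding_number (h +++ reversepath h') z = 0"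
    if "arc h" "arc h'" "pathstart h = a" "pathfinish h = b" "pathstart h' = a" "pathfinish h' = b"
      "z \<in> outside (path_image h \<union> path_image h')" for h h' :: "real \<Rightarrow> complex" and z
    using that by (intro winding_number_zero_in_outside) (auto simp: path_image_join arc_imp_path)
  note loop12 = loop[OF g1(1) g2(1) g1(2,3) g2(2,3) i12]
  have "inside (path_image g1 \<union> path_image g2) \<noteq> {}"
    using Jordan_inside_outside[OF loop12(1)] g1 g2 loop12(2) by simp
  then obtain z where z: "z \<in> inside (path_image g1 \<union> path_image g2)" by blast
  then have nz: "z \<notin> path_image g1" "z \<notin> path_image g2" "z \<notin> path_image g3"
    using out inside_no_overlap[of "path_image g1 \<union> path_image g2"] by blast+
  have "norm (winding_number (g1 +++ reversepath g2) z) = 1"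
    using simple_closed_path_norm_winding_number_inside[OF loop12(1)] z loop12(2) by simp
  then have "winding_number g1 z \<noteq> winding_number g2 z"
    using wn[OF g1(1) g2(1) g1(3) g2(3) nz(1,2)] by auto
  moreover have "winding_number g1 z = winding_number g3 z" if "z \<in> outside (path_image g1 \<union> path_image g3)"
    using wn[OF g1(1) g3(1) g1(3) g3(3) nz(1,3)] zero[OF g1(1) g3(1) g1(2,3) g3(2,3) that] by simp
  moreover have "winding_number g2 z = winding_number g3 z" if "z \<in> outside (path_image g2 \<union> path_image g3)"
    using wn[OF g2(1) g3(1) g2(3) g3(3) nz(2,3)] zero[OF g2(1) g3(1) g2(2,3) g3(2,3) that] by simp
  ultimately have "z \<notin> outside (path_image g1 \<union> path_image g3) \<or> z \<notin> outside (path_image g2 \<union> path_image g3)"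
    by metis
  moreover have "z \<in> inside K" if "z \<notin> outside K" "z \<notin> K" for K
    using that inside_Un_outside[of K] by blast
  ultimately consider "z \<in> inside (path_image g1 \<union> path_image g3)"
    | "z \<in> inside (path_image g2 \<union> path_image g3)"
    using nz by blast
  then show ?thesis
  proof cases
    case 1
    show ?thesis
      by (rule disjI1, rule step[OF g1 g2 g3(1) i12 i23 out z 1])
  next
    case 2
    have "path_image g2 \<inter> path_image g1 = {a, b}"
      "path_image g3 \<inter> inside (path_image g2 \<union> path_image g1) = {}"
      "z \<in> inside (path_image g2 \<union> path_image g1)"
      using i12 out z by (auto simp: Un_commute)
    from step[OF g2 g1 g3(1) this(1) i13 this(2,3) 2]
    show ?thesis by (simp add: Un_commute)
  qed
qed

section \<open>Vertex lists as walks\<close>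

fun arcs_of :: "'a list \<Rightarrow> ('a \<times> 'a) set" where
  "arcs_of (x # y # zs) = insert (x, y) (arcs_of (y # zs))"
| "arcs_of _ = {}"

lemma arcs_of_append: "arcs_of (xs @ y # ys) = arcs_of (xs @ [y]) \<union> arcs_of (y # ys)"
  by (induction xs rule: induct_list012) auto

lemma arcs_of_append2:
  "xs \<noteq> [] \<Longrightarrow> ys \<noteq> [] \<Longrightarrow> arcs_of (xs @ ys) = insert (last xs, hd ys) (arcs_of xs \<union> arcs_of ys)"
  by (induction xs rule: induct_list012) (auto simp: neq_Nil_conv)

lemma arcs_of_rev: "arcs_of (rev xs) = (arcs_of xs)\<inverse>"
proof (induction xs rule: induct_list012)
  case (3 x y zs)
  have "arcs_of (rev (x # y # zs)) = arcs_of (rev zs @ y # [x])" by simp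
  also have "\<dots> = arcs_of (rev (y # zs)) \<union> {(y, x)}" by (subst arcs_of_append) simp
  finally show ?case using 3 by auto
qed auto

lemma arcs_of_in_set: "(u, v) \<in> arcs_of xs \<Longrightarrow> u \<in> set xs \<and> v \<in> set (tl xs)"
  by (induction xs rule: arcs_of.induct) auto

lemma card_arcs_of: "finite (arcs_of xs) \<and> card (arcs_of xs) \<le> length xs - 1"
proof (induction xs rule: arcs_of.induct)
  case (1 x y zs)
  then show ?case by (auto intro: order_trans[OF card_insert_le_m1] simp: card_insert_if)
qed auto

text \<open>Used to see that two paths with the same ends and disjoint interiors share no edge
  unless both are the bare edge between the ends.\<close>

lemma ends_not_arc:
  assumes "distinct (a # xs @ [b])" "xs \<noteq> []"
  shows "(a, b) \<notin> arcs_of (a # xs @ [b])" "(b, a) \<notin> arcs_of (a # xs @ [b])"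
proof -
  obtain x r where xs: "xs = x # r" using assms(2) by (cases xs) auto
  show "(a, b) \<notin> arcs_of (a # xs @ [b])"
    using assms arcs_of_in_set[of a b "x # r @ [b]"] by (auto simp: xs)
  show "(b, a) \<notin> arcs_of (a # xs @ [b])"
    using assms arcs_of_in_set[of b a "a # xs @ [b]"] by auto
qed

lemma arc_cover: "w \<in> set xs \<Longrightarrow> length xs \<ge> 2 \<Longrightarrow> \<exists>(u, v)\<in>arcs_of xs. w = u \<or> w = v"
proof (induction xs rule: arcs_of.induct)
  case (1 x y zs)
  then show ?case by (cases zs) auto
qed auto

section \<open>Edges, paths and their curves in a plane drawing\<close>

locale plane_graph = sym_graph E for E :: "('a \<times> 'a) set" +
  fixes P :: "'a set" and pos :: "'a \<Rightarrow> complex" and crv :: "'a \<times> 'a \<Rightarrow> real \<Rightarrow> complex"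
  assumes finite_P: "finite P" and E_P: "E \<subseteq> P \<times> P" and inj_pos: "inj_on pos P"
    and arc_crv: "(u, v) \<in> E \<Longrightarrow> arc (crv (u, v))"
    and start_crv: "(u, v) \<in> E \<Longrightarrow> pathstart (crv (u, v)) = pos u"
    and finish_crv: "(u, v) \<in> E \<Longrightarrow> pathfinish (crv (u, v)) = pos v"
    and crv_verts: "(u, v) \<in> E \<Longrightarrow> path_image (crv (u, v)) \<inter> pos ` P = {pos u, pos v}"
    and crv_rev: "(u, v) \<in> E \<Longrightarrow> crv (v, u) = reversepath (crv (u, v))"
    and crv_Int: "(u, v) \<in> E \<Longrightarrow> (x, y) \<in> E \<Longrightarrow> {u, v} \<noteq> {x, y} \<Longrightarrow>
      path_image (crv (u, v)) \<inter> path_image (crv (x, y)) \<subseteq> pos ` P"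
begin

abbreviation img :: "'a \<times> 'a \<Rightarrow> complex set" where
  "img e \<equiv> path_image (crv e)"

definition open_img :: "'a \<times> 'a \<Rightarrow> complex set" where
  "open_img e = img e - {pos (fst e), pos (snd e)}"

definition path_img :: "'a list \<Rightarrow> complex set" where
  "path_img xs = (\<Union>e\<in>arcs_of xs. img e)"

definition is_path :: "'a list \<Rightarrow> bool" where
  "is_path xs \<longleftrightarrow> distinct xs \<and> set xs \<subseteq> P \<and> arcs_of xs \<subseteq> E"

lemma img_commute: "(u, v) \<in> E \<Longrightarrow> img (v, u) = img (u, v)"
  by (simp add: crv_rev)

lemma pos_eq_iff: "u \<in> P \<Longrightarrow> v \<in> P \<Longrightarrow> pos u = pos v \<longleftrightarrow> u = v"
  using inj_pos by (auto dest: inj_onD)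

lemma E_verts: "(u, v) \<in> E \<Longrightarrow> u \<in> P \<and> v \<in> P \<and> u \<noteq> v"
  using E_P E_irrefl by auto

lemma pos_in_img_iff: "(u, v) \<in> E \<Longrightarrow> w \<in> P \<Longrightarrow> pos w \<in> img (u, v) \<longleftrightarrow> w = u \<or> w = v"
  using crv_verts[of u v] pos_eq_iff[of w] E_verts[of u v] by blast

lemma img_meet:
  assumes "(u, v) \<in> E" "(x, y) \<in> E" "{u, v} \<noteq> {x, y}" "p \<in> img (u, v)" "p \<in> img (x, y)"
  shows "\<exists>w\<in>P. p = pos w \<and> w \<in> {u, v} \<and> w \<in> {x, y}"
proof -
  obtain w where "w \<in> P" "p = pos w" using crv_Int[OF assms(1-3)] assms(4,5) by blast
  then show ?thesis using assms pos_in_img_iff[of _ _ w] by blast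
qed

lemma open_img_props:
  assumes "(u, v) \<in> E"
  shows "topological_space_class.connected (open_img (u, v))" "open_img (u, v) \<noteq> {}" "open_img (u, v) \<inter> pos ` P = {}"
    "open_img (v, u) = open_img (u, v)"
proof -
  have s: "simple_path (crv (u, v))" using arc_crv[OF assms] by (rule arc_imp_simple_path)
  show "topological_space_class.connected (open_img (u, v))" "open_img (u, v) \<noteq> {}"
    using connected_simple_path_endless[OF s] nonempty_simple_path_endless[OF s]
      start_crv[OF assms] finish_crv[OF assms] by (auto simp: open_img_def)
  show "open_img (u, v) \<inter> pos ` P = {}"
    using crv_verts[OF assms] by (auto simp: open_img_def)
  show "open_img (v, u) = open_img (u, v)"
    using img_commute[OF assms] by (auto simp: open_img_def)
qed

text \<open>Serves for an edge that starts on a cycle and ends off it: with the start removed, the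
  curve misses the cycle and is still connected, so it stays on one side.\<close>

lemma connected_half_open:
  assumes "(u, v) \<in> E"
  shows "topological_space_class.connected (img (u, v) - {pos u})"
proof -
  let ?g = "crv (u, v)"
  have inj: "inj_on ?g {0..1}" and cont: "continuous_on {0..1} ?g" and g0: "?g 0 = pos u"
    using arc_crv[OF assms] start_crv[OF assms] by (auto simp: arc_def path_def pathstart_def)
  have "img (u, v) - {pos u} = ?g ` {0..1} - ?g ` {0}" by (simp add: path_image_def g0)
  also have "\<dots> = ?g ` ({0..1} - {0})" using inj by (subst inj_on_image_set_diff) auto
  also have "{0..1} - {0} = {0<..1::real}" by auto
  finally have "img (u, v) - {pos u} = ?g ` {0<..1}" .
  moreover have "topological_space_class.connected (?g ` {0<..1})"
    using cont by (intro connected_continuous_image) (auto intro: continuous_on_subset)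
  ultimately show ?thesis by simp
qed

lemma path_img_rev: "arcs_of xs \<subseteq> E \<Longrightarrow> path_img (rev xs) = path_img xs"
proof -
  assume "arcs_of xs \<subseteq> E"
  then have "img (v, u) = img (u, v)" if "(u, v) \<in> arcs_of xs" for u v
    using that img_commute by blast
  then show ?thesis by (fastforce simp: path_img_def arcs_of_rev)
qed

lemma is_path_rev [simp]: "is_path (rev xs) \<longleftrightarrow> is_path xs"
proof -
  have "E\<inverse> = E" by (rule set_eqI) (metis E_sym converse_iff surj_pair)
  then have "A\<inverse> \<subseteq> E \<longleftrightarrow> A \<subseteq> E" for A by (metis converse_mono)
  then show ?thesis by (simp add: is_path_def arcs_of_rev)
qed

lemma pos_in_path_img:
  assumes "arcs_of xs \<subseteq> E" "w \<in> P" "pos w \<in> path_img xs"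
  shows "w \<in> set xs"
proof -
  obtain u v where uv: "(u, v) \<in> arcs_of xs" "pos w \<in> img (u, v)"
    using assms(3) by (auto simp: path_img_def)
  then have "w = u \<or> w = v" using assms pos_in_img_iff[of u v w] by auto
  then show ?thesis using arcs_of_in_set[OF uv(1)] by (auto dest: list.set_sel(2)[rotated])
qed

lemma pos_in_path_img_iff:
  assumes "arcs_of xs \<subseteq> E" "length xs \<ge> 2" "w \<in> P"
  shows "pos w \<in> path_img xs \<longleftrightarrow> w \<in> set xs"
proof
  assume "w \<in> set xs"
  then obtain u v where "(u, v) \<in> arcs_of xs" "w = u \<or> w = v"
    using arc_cover assms(2) by fastforce
  then show "pos w \<in> path_img xs"
    using assms(1) pos_in_img_iff[of u v w] \<open>w \<in> P\<close> by (auto simp: path_img_def)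
qed (use assms pos_in_path_img in blast)

lemma path_img_meet:
  assumes "arcs_of xs \<subseteq> E" "arcs_of ys \<subseteq> E"
    and "\<And>u v x y. (u, v) \<in> arcs_of xs \<Longrightarrow> (x, y) \<in> arcs_of ys \<Longrightarrow> {u, v} \<noteq> {x, y}"
    and "p \<in> path_img xs" "p \<in> path_img ys"
  shows "\<exists>w\<in>set xs \<inter> set ys. p = pos w"
proof -
  obtain u v x y where e: "(u, v) \<in> arcs_of xs" "p \<in> img (u, v)" "(x, y) \<in> arcs_of ys" "p \<in> img (x, y)"
    using assms(4,5) by (auto simp: path_img_def)
  then obtain w where w: "p = pos w" "w \<in> {u, v}" "w \<in> {x, y}"
    using img_meet[of u v x y p] assms(1-3) by blast
  have "set (tl zs) \<subseteq> set zs" for zs :: "'a list" by (cases zs) auto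
  then have "w \<in> set xs" "w \<in> set ys"
    using w arcs_of_in_set[OF e(1)] arcs_of_in_set[OF e(3)] by blast+
  then show ?thesis using w by blast
qed

lemma path_arc:
  assumes "is_path xs" "length xs \<ge> 2"
  shows "\<exists>g. arc g \<and> pathstart g = pos (hd xs) \<and> pathfinish g = pos (last xs) \<and> path_image g = path_img xs"
  using assms
proof (induction xs rule: arcs_of.induct)
  case (1 x y zs)
  have xy: "(x, y) \<in> E" and p: "is_path (y # zs)" and x: "x \<notin> set (y # zs)" "x \<in> P"
    using 1(2) by (auto simp: is_path_def)
  show ?case
  proof (cases zs)
    case Nil
    then show ?thesis
      using xy by (intro exI[of _ "crv (x, y)"]) (auto simp: arc_crv start_crv finish_crv path_img_def)
  next
    case (Cons z r)
    then obtain g where g: "arc g" "pathstart g = pos y" "pathfinish g = pos (last (y # zs))"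
      "path_image g = path_img (y # zs)"
      using 1(1)[OF p] by auto
    have "q = pos y" if q: "q \<in> img (x, y)" "q \<in> path_img (y # zs)" for q
    proof -
      have "\<exists>w\<in>set [x, y] \<inter> set (y # zs). q = pos w"
      proof (rule path_img_meet)
        show "arcs_of [x, y] \<subseteq> E" "arcs_of (y # zs) \<subseteq> E" using xy p by (auto simp: is_path_def)
        show "q \<in> path_img [x, y]" "q \<in> path_img (y # zs)" using q by (auto simp: path_img_def)
        fix u v x' y'
        assume uv: "(u, v) \<in> arcs_of [x, y]" and xy': "(x', y') \<in> arcs_of (y # zs)"
        have "x' \<in> set (y # zs)" "y' \<in> set (y # zs)"
          using arcs_of_in_set[OF xy'] by auto
        then show "{u, v} \<noteq> {x', y'}" using uv x by auto
      qed
      then show ?thesis using x by auto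
    qed
    then have "arc (crv (x, y) +++ g)"
      using arc_crv[OF xy] g finish_crv[OF xy] by (intro arc_join) auto
    then show ?thesis
      using g start_crv[OF xy] finish_crv[OF xy]
      by (intro exI[of _ "crv (x, y) +++ g"]) (auto simp: path_image_join path_img_def)
  qed
qed auto

text \<open>Edges meet only in common ends, so a further common point could come only from a common
  edge. Its ends would both lie in \<open>{a, b}\<close>, but a path with inner vertices does not
  contain the edge between its own ends.\<close>

lemma disjoint_paths_meet:
  assumes p: "is_path (a # xs @ [b])" "is_path (a # ys @ [b])" "set xs \<inter> set ys = {}"
    and ne: "xs \<noteq> [] \<or> ys \<noteq> []"
  shows "path_img (a # xs @ [b]) \<inter> path_img (a # ys @ [b]) = {pos a, pos b}"
proof -
  have d: "a \<notin> set xs" "a \<notin> set ys" "b \<notin> set xs" "b \<notin> set ys" "a \<noteq> b" "a \<in> P" "b \<in> P"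
    and dist: "distinct (a # xs @ [b])" "distinct (a # ys @ [b])"
    using p by (auto simp: is_path_def)
  have sets: "set (a # xs @ [b]) \<inter> set (a # ys @ [b]) = {a, b}" using p(3) d by auto
  have "\<exists>w\<in>set (a # xs @ [b]) \<inter> set (a # ys @ [b]). q = pos w"
    if "q \<in> path_img (a # xs @ [b])" "q \<in> path_img (a # ys @ [b])" for q
  proof (rule path_img_meet[OF _ _ _ that])
    fix u v x y
    assume e: "(u, v) \<in> arcs_of (a # xs @ [b])" "(x, y) \<in> arcs_of (a # ys @ [b])"
    show "{u, v} \<noteq> {x, y}"
    proof
      assume eq: "{u, v} = {x, y}"
      have uv: "u \<noteq> v" using e(1) p(1) E_verts by (auto simp: is_path_def)
      have "u \<in> set (a # xs @ [b])" "v \<in> set (a # xs @ [b])" "{x, y} \<subseteq> set (a # ys @ [b])"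
        using arcs_of_in_set[OF e(1)] arcs_of_in_set[OF e(2)] by auto
      then have "u \<in> set (a # xs @ [b]) \<inter> set (a # ys @ [b])" "v \<in> set (a # xs @ [b]) \<inter> set (a # ys @ [b])"
        using eq by blast+
      then have "u \<in> {a, b}" "v \<in> {a, b}" unfolding sets by simp_all
      then have ab: "(u, v) = (a, b) \<or> (u, v) = (b, a)" using uv by auto
      then have "(x, y) = (a, b) \<or> (x, y) = (b, a)" using eq by (auto simp: doubleton_eq_iff)
      then show False
        using ab ne ends_not_arc[OF dist(1)] ends_not_arc[OF dist(2)] e by (cases "xs = []") metis+
    qed
  next
    show "arcs_of (a # xs @ [b]) \<subseteq> E" "arcs_of (a # ys @ [b]) \<subseteq> E" using p by (simp_all add: is_path_def)
  qed
  moreover have "pos w \<in> path_img (a # xs @ [b]) \<inter> path_img (a # ys @ [b])" if "w \<in> {a, b}" for w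
    using that p d pos_in_path_img_iff[of "a # xs @ [b]" w] pos_in_path_img_iff[of "a # ys @ [b]" w]
    by (auto simp: is_path_def)
  ultimately show ?thesis unfolding sets by (intro equalityI subsetI) auto
qed

end

section \<open>Inseparable graphs and ears\<close>

context sym_graph
begin

text \<open>Covers disconnected graphs (empty overlap) and cut vertices (overlap of size 1). A
  single vertex and a single edge count as inseparable, so they need separate treatment
  later.\<close>

definition separable :: "'a set \<Rightarrow> bool" where
  "separable V \<longleftrightarrow> (\<exists>V1 V2. V1 \<union> V2 = V \<and> V1 \<noteq> V \<and> V2 \<noteq> V \<and> card (V1 \<inter> V2) \<le> 1 \<and>
     (\<forall>x\<in>V1 - V2. \<forall>y\<in>V2 - V1. (x, y) \<notin> E))"

text \<open>If the new first vertex already lies on the path, the path is cut back to start there,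
  which keeps it simple.\<close>

lemma rtrancl_path:
  assumes "(x, y) \<in> r\<^sup>*"
  shows "\<exists>ws. ws \<noteq> [] \<and> hd ws = x \<and> last ws = y \<and> distinct ws \<and> arcs_of ws \<subseteq> r \<and> set ws \<subseteq> r\<^sup>* `` {x}"
  using assms
proof (induction rule: converse_rtrancl_induct)
  case base
  then show ?case by (intro exI[of _ "[y]"]) auto
next
  case (step x z)
  then obtain ws where ws: "ws \<noteq> []" "hd ws = z" "last ws = y" "distinct ws" "arcs_of ws \<subseteq> r"
    "set ws \<subseteq> r\<^sup>* `` {z}" by blast
  have sub: "set ws \<subseteq> r\<^sup>* `` {x}"
    using ws(6) step(1) by (auto intro: converse_rtrancl_into_rtrancl)
  show ?case
  proof (cases "x \<in> set ws")
    case True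
    then obtain us vs where uv: "ws = us @ x # vs" by (auto dest: split_list)
    have "arcs_of (x # vs) \<subseteq> r" using ws(5) arcs_of_append[of us x vs] by (simp add: uv)
    then show ?thesis
      using ws sub by (intro exI[of _ "x # vs"]) (auto simp: uv)
  next
    case False
    obtain us where us: "ws = z # us" using ws(1,2) by (cases ws) auto
    show ?thesis
      using ws sub False step(1) by (intro exI[of _ "x # ws"]) (auto simp: us)
  qed
qed

text \<open>If the component \<open>W\<close> of \<open>v\<close> outside \<open>C\<close> were
  attached to \<open>C\<close> in at most one vertex, cutting there would separate \<open>V\<close>.
  So there are two attachments, and they are joined through \<open>W\<close>. That the interior
  stays in the component of \<open>v\<close> is recorded because it will force the whole ear onto
  one side of a closed curve.\<close>

lemma exists_ear:
  assumes "finite V" "\<not> separable V" "C \<subseteq> V" "card C \<ge> 2" "v \<in> V - C"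
  defines "r \<equiv> E \<inter> (V - C) \<times> (V - C)"
  shows "\<exists>a ws b. a \<in> C \<and> b \<in> C \<and> ws \<noteq> [] \<and> distinct (a # ws @ [b]) \<and>
    arcs_of (a # ws @ [b]) \<subseteq> E \<and> set ws \<subseteq> r\<^sup>* `` {v} \<and> set ws \<subseteq> V - C"
proof -
  define W where "W = r\<^sup>* `` {v}"
  define N where "N = {c \<in> C. \<exists>w\<in>W. (c, w) \<in> E}"
  have W: "W \<subseteq> V - C"
  proof
    fix w assume "w \<in> W"
    then have "(v, w) \<in> r\<^sup>*" by (simp add: W_def)
    then show "w \<in> V - C" by (induction rule: rtrancl_induct) (use assms(5) in \<open>auto simp: r_def\<close>)
  qed
  have vW: "v \<in> W" by (simp add: W_def)
  have Wstep: "y \<in> W" if "x \<in> W" "(x, y) \<in> E" "y \<in> V - C" for x y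
  proof -
    have "(x, y) \<in> r" using that W by (auto simp: r_def)
    then show ?thesis using that(1) unfolding W_def by (auto intro: rtrancl_into_rtrancl)
  qed
  have fin: "finite C" using assms(1,3) finite_subset by blast
  have "\<not> card N \<le> 1"
  proof
    assume N1: "card N \<le> 1"
    have "(W \<union> N) \<inter> (V - W) = N" using W assms(3) by (auto simp: N_def)
    moreover have "(W \<union> N) \<union> (V - W) = V" using W assms(3) by (auto simp: N_def)
    moreover have "W \<union> N \<noteq> V"
    proof
      assume "W \<union> N = V"
      then have "C \<subseteq> N" using W assms(3) by auto
      then have "card C \<le> card N" using fin by (intro card_mono) (auto simp: N_def)
      then show False using N1 assms(4) by simp
    qed
    moreover have "V - W \<noteq> V" using vW assms(5) by auto
    moreover have "(x, y) \<notin> E" if "x \<in> (W \<union> N) - (V - W)" "y \<in> (V - W) - (W \<union> N)" for x y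
    proof
      assume xy: "(x, y) \<in> E"
      have x: "x \<in> W" using that(1) assms(3) by (auto simp: N_def)
      show False
      proof (cases "y \<in> C")
        case True
        then have "y \<in> N" using x E_sym[OF xy] by (auto simp: N_def)
        then show False using that(2) by simp
      next
        case False
        then show False using Wstep[OF x xy] that(2) by simp
      qed
    qed
    ultimately have "separable V"
      unfolding separable_def using N1 by (intro exI[of _ "W \<union> N"] exI[of _ "V - W"]) simp
    then show False using assms(2) by simp
  qed
  then obtain a b where ab: "a \<in> N" "b \<in> N" "a \<noteq> b"
    using card_le_Suc0_iff_eq[of N] fin by (auto simp: N_def)
  obtain wa wb where w: "wa \<in> W" "(a, wa) \<in> E" "wb \<in> W" "(b, wb) \<in> E" using ab by (auto simp: N_def)
  have "(y, x) \<in> r" if "(x, y) \<in> r" for x y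
    using that E_sym[of x y] by (simp add: r_def)
  then have "sym (r\<^sup>*)" by (intro sym_rtrancl symI)
  moreover have "(v, wa) \<in> r\<^sup>*" "(v, wb) \<in> r\<^sup>*" using w(1,3) by (simp_all add: W_def)
  ultimately have "(wa, wb) \<in> r\<^sup>*" by (metis symD rtrancl_trans)
  from rtrancl_path[OF this] obtain ws where ws: "ws \<noteq> []" "hd ws = wa" "last ws = wb" "distinct ws"
    "arcs_of ws \<subseteq> r" "set ws \<subseteq> r\<^sup>* `` {wa}" by blast
  have wsW: "set ws \<subseteq> W"
  proof
    fix x assume "x \<in> set ws"
    then have "(wa, x) \<in> r\<^sup>*" using ws(6) by blast
    with \<open>(v, wa) \<in> r\<^sup>*\<close> show "x \<in> W" unfolding W_def by (auto dest: rtrancl_trans)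
  qed
  have arcs: "arcs_of (a # ws @ [b]) = insert (a, wa) (insert (wb, b) (arcs_of ws))"
    using arcs_of_append2[of "[a]" "ws @ [b]"] arcs_of_append2[of ws "[b]"] ws(1-3) by simp
  have "arcs_of (a # ws @ [b]) \<subseteq> E"
    unfolding arcs using w E_sym[OF w(4)] ws(5) by (auto simp: r_def)
  moreover have abC: "a \<in> C" "b \<in> C" using ab by (simp_all add: N_def)
  then have "distinct (a # ws @ [b])" using ws(4) ab(3) wsW W by auto
  moreover have "set ws \<subseteq> V - C" using wsW W by blast
  ultimately show ?thesis
    using abC ws(1) wsW unfolding W_def by blast
qed

end

section \<open>Cycles as closed curves and their two sides\<close>

context plane_graph
begin

definition is_cycle :: "'a list \<Rightarrow> bool" where
  "is_cycle c \<longleftrightarrow> length c \<ge> 3 \<and> distinct c \<and> set c \<subseteq> P \<and> arcs_of (c @ [hd c]) \<subseteq> E"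

definition cycle_img :: "'a list \<Rightarrow> complex set" where
  "cycle_img c = path_img (c @ [hd c])"

lemma cycle_rotate:
  assumes "is_cycle (us @ vs)"
  shows "is_cycle (vs @ us)" "cycle_img (vs @ us) = cycle_img (us @ vs)"
proof -
  have "arcs_of ((vs @ us) @ [hd (vs @ us)]) = arcs_of ((us @ vs) @ [hd (us @ vs)])"
  proof (cases "us = [] \<or> vs = []")
    case False
    have "arcs_of ((us @ vs) @ [hd (us @ vs)]) =
        insert (last us, hd vs) (arcs_of us \<union> insert (last vs, hd us) (arcs_of vs))"
      if "us \<noteq> []" "vs \<noteq> []" for us vs :: "'a list"
      using arcs_of_append2[of us "vs @ [hd us]"] arcs_of_append2[of vs "[hd us]"] that by simp
    from this[of us vs] this[of vs us] show ?thesis using False by auto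
  qed auto
  then show "is_cycle (vs @ us)" "cycle_img (vs @ us) = cycle_img (us @ vs)"
    using assms by (auto simp: is_cycle_def cycle_img_def path_img_def)
qed

text \<open>Both halves are oriented from \<open>a\<close> to \<open>b\<close>, one of them being
  reversed, since theta-curves are formed by arcs with the same start and the same end. The converse
  construction is \<open>cycle_join\<close>.\<close>

lemma cycle_split:
  assumes "is_cycle c" "a \<in> set c" "b \<in> set c" "a \<noteq> b"
  shows "\<exists>xs ys. is_path (a # xs @ [b]) \<and> is_path (a # ys @ [b]) \<and> set xs \<inter> set ys = {} \<and>
    (xs \<noteq> [] \<or> ys \<noteq> []) \<and> set c = {a, b} \<union> set xs \<union> set ys \<and> length c = 2 + length xs + length ys \<and>
    cycle_img c = path_img (a # xs @ [b]) \<union> path_img (a # ys @ [b])"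
proof -
  obtain us vs where c: "c = us @ a # vs" using assms(2) by (auto dest: split_list)
  have c': "is_cycle (a # vs @ us)" "cycle_img (a # vs @ us) = cycle_img c"
    using cycle_rotate[of us "a # vs"] assms(1) by (simp_all add: c)
  have "b \<in> set (vs @ us)" using assms(3,4) by (auto simp: c)
  then obtain xs zs where xz: "vs @ us = xs @ b # zs" by (meson split_list)
  have arcs: "arcs_of (a # xs @ b # zs @ [a]) = arcs_of (a # xs @ [b]) \<union> arcs_of (b # zs @ [a])"
    using arcs_of_append[of "a # xs" b "zs @ [a]"] by simp
  have cyc: "is_cycle (a # xs @ b # zs)" using c' by (simp add: xz)
  then have E: "arcs_of (a # xs @ [b]) \<subseteq> E" "arcs_of (b # zs @ [a]) \<subseteq> E"
    by (simp_all add: is_cycle_def arcs)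
  have paths: "is_path (a # xs @ [b])" "is_path (b # zs @ [a])"
    using cyc E by (auto simp: is_path_def is_cycle_def)
  have rv: "rev (b # zs @ [a]) = a # rev zs @ [b]" by simp
  have "is_path (a # rev zs @ [b])" using is_path_rev[of "b # zs @ [a]"] paths unfolding rv by simp
  moreover have "path_img (a # rev zs @ [b]) = path_img (b # zs @ [a])"
    using path_img_rev[OF E(2)] unfolding rv .
  moreover have "cycle_img c = path_img (a # xs @ [b]) \<union> path_img (b # zs @ [a])"
  proof -
    have "cycle_img c = cycle_img (a # xs @ b # zs)" using c'(2) by (simp only: xz)
    also have "\<dots> = path_img (a # xs @ b # zs @ [a])" by (simp add: cycle_img_def)
    finally show ?thesis by (simp only: path_img_def arcs UN_Un)
  qed
  moreover have "set c = set (a # vs @ us)" "length c = length (a # vs @ us)" by (auto simp: c)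
  moreover have "set xs \<inter> set zs = {}" "xs \<noteq> [] \<or> zs \<noteq> []"
    using cyc by (auto simp: is_cycle_def)
  ultimately show ?thesis
    using paths(1) by (intro exI[of _ xs] exI[of _ "rev zs"]) (auto simp: xz)
qed

lemma cycle_join:
  assumes p: "is_path (a # xs @ [b])" "is_path (a # ys @ [b])" "set xs \<inter> set ys = {}" "xs \<noteq> [] \<or> ys \<noteq> []"
  defines "c \<equiv> a # xs @ b # rev ys"
  shows "is_cycle c" "cycle_img c = path_img (a # xs @ [b]) \<union> path_img (a # ys @ [b])"
proof -
  have rv: "rev (a # ys @ [b]) = b # rev ys @ [a]" by simp
  have arcs: "arcs_of (c @ [hd c]) = arcs_of (a # xs @ [b]) \<union> arcs_of (b # rev ys @ [a])"
    using arcs_of_append[of "a # xs" b "rev ys @ [a]"] by (simp add: c_def)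
  have q: "is_path (b # rev ys @ [a])" using is_path_rev[of "a # ys @ [b]"] p(2) unfolding rv by simp
  have "length c \<ge> 3" using p(4) by (cases xs; cases ys) (auto simp: c_def)
  then show "is_cycle c"
    using p q arcs by (auto simp: is_cycle_def is_path_def c_def)
  have "path_img (b # rev ys @ [a]) = path_img (a # ys @ [b])"
    using path_img_rev[of "a # ys @ [b]"] p(2) unfolding rv by (simp add: is_path_def)
  then show "cycle_img c = path_img (a # xs @ [b]) \<union> path_img (a # ys @ [b])"
    unfolding cycle_img_def path_img_def arcs by auto
qed

lemma cycle_hd_last: "is_cycle c \<Longrightarrow> hd c \<in> set c" "is_cycle c \<Longrightarrow> set (c @ [hd c]) = set c"
  by (cases c; auto simp: is_cycle_def)+

lemma pos_in_cycle_img_iff: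
  assumes "is_cycle c" "w \<in> P"
  shows "pos w \<in> cycle_img c \<longleftrightarrow> w \<in> set c"
  unfolding cycle_img_def
  using pos_in_path_img_iff[of "c @ [hd c]" w] assms cycle_hd_last(1)[OF assms(1)]
  by (auto simp: is_cycle_def)

lemma closed_path_img: "arcs_of xs \<subseteq> E \<Longrightarrow> closed (path_img xs)"
  unfolding path_img_def using card_arcs_of[of xs]
  by (intro closed_UN) (auto intro!: closed_arc_image arc_crv)

lemma closed_cycle_img: "is_cycle c \<Longrightarrow> closed (cycle_img c)"
  unfolding cycle_img_def by (rule closed_path_img) (simp add: is_cycle_def)

lemma inside_cycle_nonempty:
  assumes "is_cycle c"
  shows "inside (cycle_img c) \<noteq> {}"
proof -
  obtain a b r where c: "c = a # b # r" using assms by (cases c rule: arcs_of.cases) (auto simp: is_cycle_def)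
  then have "a \<noteq> b" using assms by (auto simp: is_cycle_def)
  then obtain xs ys where p: "is_path (a # xs @ [b])" "is_path (a # ys @ [b])" "set xs \<inter> set ys = {}"
    "xs \<noteq> [] \<or> ys \<noteq> []" "cycle_img c = path_img (a # xs @ [b]) \<union> path_img (a # ys @ [b])"
    using cycle_split[OF assms, of a b] by (auto simp: c)
  obtain g where g: "arc g" "pathstart g = pos a" "pathfinish g = pos b" "path_image g = path_img (a # xs @ [b])"
    using path_arc[OF p(1)] by auto
  obtain h where h: "arc h" "pathstart h = pos a" "pathfinish h = pos b" "path_image h = path_img (a # ys @ [b])"
    using path_arc[OF p(2)] by auto
  have "simple_path (g +++ reversepath h)" "pathfinish (g +++ reversepath h) = pathstart (g +++ reversepath h)"
    using g h disjoint_paths_meet[OF p(1-4)] by (auto simp: simple_path_join_loop_eq arc_reversepath)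
  from Jordan_inside_outside[OF this] show ?thesis
    using g h p(5) by (simp add: path_image_join)
qed

lemma arc_meets_cycle:
  assumes "is_cycle c" "(u, v) \<in> E" "\<And>x y. (x, y) \<in> arcs_of (c @ [hd c]) \<Longrightarrow> {u, v} \<noteq> {x, y}"
    and "p \<in> img (u, v)" "p \<in> cycle_img c"
  shows "\<exists>w\<in>{u, v} \<inter> set c. p = pos w"
proof -
  have "\<exists>w\<in>set [u, v] \<inter> set (c @ [hd c]). p = pos w"
  proof (rule path_img_meet)
    show "arcs_of [u, v] \<subseteq> E" "arcs_of (c @ [hd c]) \<subseteq> E"
      using assms(1,2) by (simp_all add: is_cycle_def)
    show "p \<in> path_img [u, v]" "p \<in> path_img (c @ [hd c])"
      using assms(4,5) by (simp_all add: path_img_def cycle_img_def)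
  qed (use assms(3) in auto)
  then show ?thesis using cycle_hd_last(2)[OF assms(1)] by simp
qed

text \<open>Ears are needed inside a cycle, to cut a disc, and outside it, to enlarge the disc; the
  argument is the same for both sides.\<close>

definition side_of :: "complex set \<Rightarrow> 'a list \<Rightarrow> bool" where
  "side_of Z c \<longleftrightarrow> is_cycle c \<and> (Z = inside (cycle_img c) \<or> Z = outside (cycle_img c))"

lemma side_connected:
  assumes "side_of Z c" "topological_space_class.connected T" "T \<inter> cycle_img c = {}" "p \<in> T" "p \<in> Z"
  shows "T \<subseteq> Z"
proof -
  have "T \<subseteq> inside (cycle_img c) \<or> T \<subseteq> outside (cycle_img c)"
    using assms closed_cycle_img by (intro connected_inside_or_outside) (auto simp: side_of_def)
  then show ?thesis
    using assms inside_Int_outside[of "cycle_img c"] unfolding side_of_def by blast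
qed

lemma arc_off_cycle:
  assumes "side_of Z c" "(x, y) \<in> E" "y \<notin> set c" "pos y \<in> Z"
  shows "img (x, y) \<subseteq> insert (pos x) Z" "x \<notin> set c \<Longrightarrow> pos x \<in> Z"
proof -
  have cyc: "is_cycle c" using assms(1) by (simp add: side_of_def)
  have ne: "{x, y} \<noteq> {u, v}" if "(u, v) \<in> arcs_of (c @ [hd c])" for u v
  proof -
    have "u \<in> set c" "v \<in> set (tl (c @ [hd c]))"
      using arcs_of_in_set[OF that] cycle_hd_last[OF cyc] by auto
    moreover have "set (tl (c @ [hd c])) \<subseteq> set c"
      using cycle_hd_last[OF cyc] by (cases c) auto
    ultimately show ?thesis using assms(3) by auto
  qed
  have meet: "p = pos x \<and> x \<in> set c" if "p \<in> img (x, y)" "p \<in> cycle_img c" for p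
    using arc_meets_cycle[OF cyc assms(2) ne that] assms(3) by auto
  have ends: "pos x \<in> img (x, y)" "pos y \<in> img (x, y)" "pos x \<noteq> pos y"
    using crv_verts[OF assms(2)] pos_eq_iff E_verts[OF assms(2)] by auto
  have "img (x, y) - {pos x} \<subseteq> Z"
    by (rule side_connected[OF assms(1) connected_half_open[OF assms(2)], of "pos y"])
      (use meet ends assms(4) in auto)
  then show "img (x, y) \<subseteq> insert (pos x) Z" by auto
  show "pos x \<in> Z" if "x \<notin> set c"
  proof -
    have "topological_space_class.connected (img (x, y))"
      using arc_crv[OF assms(2)] by (intro connected_path_image arc_imp_path)
    moreover have "img (x, y) \<inter> cycle_img c = {}" using meet that by auto
    ultimately have "img (x, y) \<subseteq> Z" using side_connected[OF assms(1)] ends assms(4) by blast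
    then show ?thesis using ends by blast
  qed
qed

text \<open>An arc with both ends on \<open>c\<close> is itself an ear. Otherwise one end
  \<open>y\<close> lies off \<open>c\<close> and in \<open>Z\<close>, and an ear is taken through
  the component of \<open>y\<close> outside \<open>c\<close>. Edges within that component never meet
  the curve, so all inner vertices lie in \<open>Z\<close>, and the two end edges leave
  \<open>Z\<close> only at \<open>a\<close> and \<open>b\<close>.\<close>

lemma ear_in_side:
  assumes V: "V \<subseteq> P" "\<not> separable V" "set c \<subseteq> V" and Z: "side_of Z c"
    and e: "(u, v) \<in> E" "u \<in> V" "v \<in> V" "open_img (u, v) \<subseteq> Z"
  shows "\<exists>a ws b. a \<in> set c \<and> b \<in> set c \<and> is_path (a # ws @ [b]) \<and> set ws \<subseteq> V - set c \<and>
    path_img (a # ws @ [b]) \<subseteq> Z \<union> {pos a, pos b}"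
proof (cases "u \<in> set c \<and> v \<in> set c")
  case True
  then have uv: "u \<in> set c" "v \<in> set c" by simp_all
  have "img (u, v) \<subseteq> Z \<union> {pos u, pos v}" using e(4) by (auto simp: open_img_def)
  then show ?thesis
    using uv e(1) E_verts[OF e(1)]
    by (intro exI[of _ u] exI[of _ "[]"] exI[of _ v]) (simp add: is_path_def path_img_def)
next
  case False
  have cyc: "is_cycle c" using Z by (simp add: side_of_def)
  have fV: "finite V" using V(1) finite_P finite_subset by blast
  have "\<exists>x y. (x, y) \<in> E \<and> y \<in> V - set c \<and> open_img (x, y) \<subseteq> Z"
  proof (cases "v \<in> set c")
    case True
    then show ?thesis
      using False e(2,4) E_sym[OF e(1)] open_img_props(4)[OF e(1)]
      by (intro exI[of _ v] exI[of _ u]) simp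
  next
    case False
    then show ?thesis using e by (intro exI[of _ u] exI[of _ v]) simp
  qed
  then obtain x y where xy: "(x, y) \<in> E" "y \<in> V - set c" "open_img (x, y) \<subseteq> Z" by blast
  have "pos y \<in> Z"
  proof -
    have ends: "pos y \<in> img (x, y)" "pos x \<noteq> pos y"
      using crv_verts[OF xy(1)] pos_eq_iff E_verts[OF xy(1)] by auto
    obtain p where p: "p \<in> open_img (x, y)" using open_img_props(2)[OF xy(1)] by blast
    have "img (x, y) - {pos x} \<subseteq> open_img (x, y) \<union> {pos y}" by (auto simp: open_img_def)
    moreover have "open_img (x, y) \<inter> cycle_img c = {}"
      using xy(3) Z inside_no_overlap[of "cycle_img c"] outside_no_overlap[of "cycle_img c"]
      unfolding side_of_def by blast
    moreover have "pos y \<notin> cycle_img c"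
      using pos_in_cycle_img_iff[OF cyc, of y] xy(2) V(1) by auto
    ultimately have "(img (x, y) - {pos x}) \<inter> cycle_img c = {}" by blast
    then have "img (x, y) - {pos x} \<subseteq> Z"
      using p xy(3) by (intro side_connected[OF Z connected_half_open[OF xy(1)], of p])
        (auto simp: open_img_def)
    moreover have "pos y \<in> img (x, y) - {pos x}" using ends by simp
    ultimately show ?thesis by (rule subsetD)
  qed
  let ?r = "E \<inter> (V - set c) \<times> (V - set c)"
  have "card (set c) \<ge> 2" using cyc by (simp add: is_cycle_def distinct_card)
  from exists_ear[OF fV V(2,3) this xy(2)]
  obtain a ws b where ear: "a \<in> set c" "b \<in> set c" "ws \<noteq> []" "distinct (a # ws @ [b])"
    "arcs_of (a # ws @ [b]) \<subseteq> E" "set ws \<subseteq> ?r\<^sup>* `` {y}" "set ws \<subseteq> V - set c" by blast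
  have inZ: "pos w \<in> Z" if "w \<in> set ws" for w
  proof -
    have "(y, w) \<in> ?r\<^sup>*" using ear(6) that by blast
    then show ?thesis
    proof (induction rule: rtrancl_induct)
      case base
      then show ?case by (rule \<open>pos y \<in> Z\<close>)
    next
      case (step w w')
      then have "(w', w) \<in> E" "w \<notin> set c" "w' \<notin> set c" using E_sym[of w w'] by auto
      then show ?case using arc_off_cycle(2)[OF Z] step.IH by blast
    qed
  qed
  have "img (s, t) \<subseteq> Z \<union> {pos a, pos b}" if st: "(s, t) \<in> arcs_of (a # ws @ [b])" for s t
  proof -
    have st': "s \<in> {a, b} \<union> set ws" "t \<in> set ws \<union> {b}"
      using arcs_of_in_set[OF st] by auto
    have stE: "(s, t) \<in> E" using ear(5) st by blast
    show ?thesis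
    proof (cases "t \<in> set ws")
      case True
      then have "img (s, t) \<subseteq> insert (pos s) Z"
        using arc_off_cycle(1)[OF Z stE] inZ[of t] ear(7) by blast
      then show ?thesis using st'(1) inZ[of s] by blast
    next
      case False
      then have t: "t = b" using st'(2) by blast
      then have "s \<noteq> a" using ends_not_arc(1)[of a ws b] ear(3,4) st by blast
      moreover have "s \<noteq> b" using stE E_verts[of s t] t by blast
      ultimately have s: "s \<in> set ws" using st'(1) by blast
      then have "img (t, s) \<subseteq> insert (pos t) Z"
        using arc_off_cycle(1)[OF Z E_sym[OF stE]] inZ[of s] ear(7) by blast
      then show ?thesis using img_commute[OF stE] t by blast
    qed
  qed
  then have "path_img (a # ws @ [b]) \<subseteq> Z \<union> {pos a, pos b}"
    unfolding path_img_def by (intro UN_least) (metis surj_pair)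
  moreover have "set (a # ws @ [b]) \<subseteq> P"
    using ear(1,2,7) V(1,3) by auto
  then have "is_path (a # ws @ [b])"
    unfolding is_path_def using ear(4,5) by blast
  ultimately show ?thesis
    using ear(1,2,7) by blast
qed

end

section \<open>Euler's formula\<close>

context plane_graph
begin

lemma path_ends_removed:
  assumes "is_path (a # ws @ [b])"
  shows "path_img (a # ws @ [b]) - {pos a, pos b} \<noteq> {}"
proof -
  obtain g where g: "arc g" "pathstart g = pos a" "pathfinish g = pos b" "path_image g = path_img (a # ws @ [b])"
    using path_arc[OF assms] by auto
  then show ?thesis using nonempty_simple_path_endless[OF arc_imp_simple_path[OF g(1)]] by simp
qed

text \<open>Since the side misses the curve, the ear cannot coincide with either half of the cycle.
  Hence no two of the three paths are both the bare edge from \<open>a\<close> to \<open>b\<close>,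
  and any two of them form a cycle.\<close>

lemma ear_theta:
  assumes V: "V \<subseteq> P" "\<not> separable V" "set c \<subseteq> V" and Z: "side_of Z c"
    and e: "(u, v) \<in> E" "u \<in> V" "v \<in> V" "open_img (u, v) \<subseteq> Z"
  obtains a b xs ys ws where "is_path (a # xs @ [b])" "is_path (a # ys @ [b])" "is_path (a # ws @ [b])"
    and "set xs \<inter> set ys = {}" "set xs \<inter> set ws = {}" "set ys \<inter> set ws = {}"
    and "xs \<noteq> [] \<or> ys \<noteq> []" "xs \<noteq> [] \<or> ws \<noteq> []" "ys \<noteq> [] \<or> ws \<noteq> []"
    and "set c = {a, b} \<union> set xs \<union> set ys" "length c = 2 + length xs + length ys"
    and "cycle_img c = path_img (a # xs @ [b]) \<union> path_img (a # ys @ [b])"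
    and "set ws \<subseteq> V - set c" "path_img (a # ws @ [b]) \<subseteq> Z \<union> {pos a, pos b}"
proof -
  have cyc: "is_cycle c" using Z by (simp add: side_of_def)
  obtain a ws b where ear: "a \<in> set c" "b \<in> set c" "is_path (a # ws @ [b])" "set ws \<subseteq> V - set c"
    "path_img (a # ws @ [b]) \<subseteq> Z \<union> {pos a, pos b}"
    using ear_in_side[OF V Z e] by blast
  have "a \<noteq> b" using ear(3) by (simp add: is_path_def)
  from cycle_split[OF cyc ear(1,2) this] obtain xs ys where
    s: "is_path (a # xs @ [b])" "is_path (a # ys @ [b])" "set xs \<inter> set ys = {}"
    "xs \<noteq> [] \<or> ys \<noteq> []" "set c = {a, b} \<union> set xs \<union> set ys" "length c = 2 + length xs + length ys"
    "cycle_img c = path_img (a # xs @ [b]) \<union> path_img (a # ys @ [b])" by blast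
  have "Z \<inter> cycle_img c = {}"
    using Z inside_no_overlap[of "cycle_img c"] outside_no_overlap[of "cycle_img c"]
    unfolding side_of_def by blast
  then have "\<not> path_img (a # ws @ [b]) \<subseteq> cycle_img c"
    using path_ends_removed[OF ear(3)] ear(5) by blast
  then have "path_img (a # ws @ [b]) \<noteq> path_img (a # xs @ [b])" "path_img (a # ws @ [b]) \<noteq> path_img (a # ys @ [b])"
    using s(7) by auto
  then have "xs \<noteq> [] \<or> ws \<noteq> []" "ys \<noteq> [] \<or> ws \<noteq> []" by auto
  moreover have "set xs \<inter> set ws = {}" "set ys \<inter> set ws = {}" using s(5) ear(4) by auto
  ultimately show ?thesis using that[OF s(1,2) ear(3) s(3) _ _ s(4) _ _ s(5,6,7) ear(4,5)] by simp
qed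

definition inner_arcs :: "'a set \<Rightarrow> 'a list \<Rightarrow> ('a \<times> 'a) set" where
  "inner_arcs V c = {e \<in> E \<inter> V \<times> V. open_img e \<subseteq> inside (cycle_img c)}"

definition inner_verts :: "'a set \<Rightarrow> 'a list \<Rightarrow> 'a set" where
  "inner_verts V c = {v \<in> V. pos v \<in> inside (cycle_img c)}"

text \<open>Taking point sets identifies the different lists that run through the same 4-cycle, by
  rotation or reversal.\<close>

definition quads :: "'a set \<Rightarrow> complex set set" where
  "quads V = {cycle_img d | d. is_cycle d \<and> length d = 4 \<and> set d \<subseteq> V}"

text \<open>Counts every 4-cycle whose inside lies in the disc, not only faces. This bounds the
  quadrilateral faces from above, and it is superadditive when a disc is cut in two, so faces need
  not be defined.\<close>

definition inner_quads :: "'a set \<Rightarrow> 'a list \<Rightarrow> complex set set" where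
  "inner_quads V c = {Q \<in> quads V. inside Q \<subseteq> inside (cycle_img c)}"

lemma finite_cycles: "V \<subseteq> P \<Longrightarrow> finite {c. is_cycle c \<and> set c \<subseteq> V}"
  using finite_subset_distinct[OF finite_P] by (rule rev_finite_subset) (auto simp: is_cycle_def)

lemma finite_quads: "V \<subseteq> P \<Longrightarrow> finite (quads V)"
proof -
  assume "V \<subseteq> P"
  then have "finite (cycle_img ` {c. is_cycle c \<and> set c \<subseteq> V})" using finite_cycles by blast
  then show ?thesis by (rule rev_finite_subset) (auto simp: quads_def)
qed

lemma quad_inside_nonempty: "Q \<in> quads V \<Longrightarrow> inside Q \<noteq> {}"
  using inside_cycle_nonempty by (auto simp: quads_def)

lemma pos_not_in_open_img: "(u, v) \<in> E \<Longrightarrow> w \<in> P \<Longrightarrow> pos w \<notin> open_img (u, v)"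
  using open_img_props(3) by blast

text \<open>
  Euler's formula for the disc bounded by \<open>c\<close>, in the form it takes when all faces inside have
  length at least five except for the quadrilaterals. Arcs count every edge twice.
\<close>
lemma disc_bound:
  assumes V: "V \<subseteq> P" "\<not> separable V" and no3: "\<And>d. is_cycle d \<Longrightarrow> set d \<subseteq> V \<Longrightarrow> length d \<noteq> 3"
    and "is_cycle c" "set c \<subseteq> V"
  shows "3 * card (inner_arcs V c) + 10 \<le> 10 * card (inner_verts V c) + 2 * length c + 2 * card (inner_quads V c)"
  using assms(4,5)
proof (induction "card (inner_arcs V c)" arbitrary: c rule: less_induct)
  case less
  have finV: "finite V" using V(1) finite_P finite_subset by blast
  have finA: "finite (inner_arcs V d)" for d using finV by (auto simp: inner_arcs_def)
  have finv: "finite (inner_verts V d)" for d using finV by (auto simp: inner_verts_def)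
  have finQ: "finite (inner_quads V d)" for d using finite_quads[OF V(1)] by (auto simp: inner_quads_def)
  show ?case
  proof (cases "inner_arcs V c = {}")
    case True
    have "length c \<ge> 3" "length c \<noteq> 3" using less.prems no3 by (auto simp: is_cycle_def)
    \<comment> \<open>With no edge inside, the disc is a single face. Length 5 pays the 10 in full;
      length 4 pays 8, and \<open>c\<close> itself supplies the missing quadrilateral.\<close>
    then consider "length c = 4" | "length c \<ge> 5" by linarith
    then show ?thesis
    proof cases
      case 1
      then have "cycle_img c \<in> inner_quads V c" using less.prems by (auto simp: inner_quads_def quads_def)
      then have "card (inner_quads V c) \<ge> 1" using finQ[of c] by (metis card_0_eq empty_iff less_one not_less)
      then show ?thesis using True 1 by simp
    next
      case 2
      then show ?thesis using True by simp
    qed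
  next
    case False
    then obtain u v where uv: "(u, v) \<in> E" "u \<in> V" "v \<in> V" "open_img (u, v) \<subseteq> inside (cycle_img c)"
      by (auto simp: inner_arcs_def)
    have "side_of (inside (cycle_img c)) c" using less.prems by (simp add: side_of_def)
    from ear_theta[OF V less.prems(2) this uv]
    obtain a b xs ys ws where p: "is_path (a # xs @ [b])" "is_path (a # ys @ [b])" "is_path (a # ws @ [b])"
      and d: "set xs \<inter> set ys = {}" "set xs \<inter> set ws = {}" "set ys \<inter> set ws = {}"
      and ne: "xs \<noteq> [] \<or> ys \<noteq> []" "xs \<noteq> [] \<or> ws \<noteq> []" "ys \<noteq> [] \<or> ws \<noteq> []"
      and c: "set c = {a, b} \<union> set xs \<union> set ys" "length c = 2 + length xs + length ys"
      and ci: "cycle_img c = path_img (a # xs @ [b]) \<union> path_img (a # ys @ [b])"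
      and w: "set ws \<subseteq> V - set c" "path_img (a # ws @ [b]) \<subseteq> inside (cycle_img c) \<union> {pos a, pos b}" .
    let ?X = "path_img (a # xs @ [b])" and ?Y = "path_img (a # ys @ [b])" and ?W = "path_img (a # ws @ [b])"
    define c1 where "c1 = a # xs @ b # rev ws"
    define c2 where "c2 = a # ys @ b # rev ws"
    have cyc: "is_cycle c1" "is_cycle c2" and i1: "cycle_img c1 = ?X \<union> ?W" and i2: "cycle_img c2 = ?Y \<union> ?W"
      unfolding c1_def c2_def using cycle_join[OF p(1,3) d(2) ne(2)] cycle_join[OF p(2,3) d(3) ne(3)] by simp_all
    have cV: "set c1 \<subseteq> V" "set c2 \<subseteq> V" using c(1) w(1) less.prems(2) by (auto simp: c1_def c2_def)
    have ab: "pos a \<noteq> pos b" using p(1) by (auto simp: is_path_def pos_eq_iff)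
    obtain g1 where g1: "arc g1" "pathstart g1 = pos a" "pathfinish g1 = pos b" "path_image g1 = ?X"
      using path_arc[OF p(1)] by auto
    obtain g2 where g2: "arc g2" "pathstart g2 = pos a" "pathfinish g2 = pos b" "path_image g2 = ?Y"
      using path_arc[OF p(2)] by auto
    obtain g3 where g3: "arc g3" "pathstart g3 = pos a" "pathfinish g3 = pos b" "path_image g3 = ?W"
      using path_arc[OF p(3)] by auto
    have meets: "?X \<inter> ?Y = {pos a, pos b}" "?X \<inter> ?W = {pos a, pos b}" "?Y \<inter> ?W = {pos a, pos b}"
      using disjoint_paths_meet[OF p(1,2) d(1) ne(1)] disjoint_paths_meet[OF p(1,3) d(2) ne(2)]
        disjoint_paths_meet[OF p(2,3) d(3) ne(3)] by simp_all
    have Win: "?W \<inter> inside (?X \<union> ?Y) \<noteq> {}"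
      using path_ends_removed[OF p(3)] w(2) unfolding ci by blast
    have split: "inside (?X \<union> ?W) \<inter> inside (?Y \<union> ?W) = {}"
      "inside (?X \<union> ?W) \<union> inside (?Y \<union> ?W) \<union> (?W - {pos a, pos b}) = inside (?X \<union> ?Y)"
      using split_inside_simple_closed_curve[OF arc_imp_simple_path[OF g1(1)] g1(2,3)
          arc_imp_simple_path[OF g2(1)] g2(2,3) arc_imp_simple_path[OF g3(1)] g3(2,3) ab]
        meets Win unfolding g1(4) g2(4) g3(4) by blast+
    let ?I = "inside (cycle_img c)" and ?I1 = "inside (cycle_img c1)" and ?I2 = "inside (cycle_img c2)"
    have I: "?I1 \<inter> ?I2 = {}" "?I = ?I1 \<union> ?I2 \<union> (?W - {pos a, pos b})" "?I1 \<inter> ?W = {}" "?I2 \<inter> ?W = {}"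
      using split inside_no_overlap[of "?X \<union> ?W"] inside_no_overlap[of "?Y \<union> ?W"]
      unfolding ci i1 i2 by (simp_all add: Int_Un_distrib)
    let ?ws = "arcs_of (a # ws @ [b])"
    have wsE: "?ws \<subseteq> E" using p(3) by (simp add: is_path_def)
    have openW: "open_img e \<subseteq> ?W" if "e \<in> ?ws \<union> ?ws\<inverse>" for e
    proof -
      obtain s t where e: "e = (s, t)" by (cases e)
      have "img (s, t) \<subseteq> ?W"
      proof (cases "(s, t) \<in> ?ws")
        case True
        then show ?thesis by (auto simp: path_img_def)
      next
        case False
        then have ts: "(t, s) \<in> ?ws" using that by (simp add: e)
        then have "img (s, t) = img (t, s)" using img_commute wsE by blast
        then show ?thesis using ts by (auto simp: path_img_def)
      qed
      then show ?thesis by (auto simp: e open_img_def)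
    qed
    have open_ne: "open_img e \<noteq> {}" if "e \<in> E" for e using that open_img_props(2) by (cases e) auto
    have sub: "inner_arcs V c1 \<subseteq> inner_arcs V c" "inner_arcs V c2 \<subseteq> inner_arcs V c"
      using I(2) by (auto simp: inner_arcs_def)
    \<comment> \<open>The first edge of the ear runs inside \<open>c\<close> but on the boundary of
      either part, so the induction measure drops.\<close>
    have proper: "inner_arcs V c' \<subset> inner_arcs V c"
      if c': "inner_arcs V c' \<subseteq> inner_arcs V c" "inside (cycle_img c') \<inter> ?W = {}" for c'
    proof -
      obtain t where t: "(a, t) \<in> ?ws" by (cases ws) auto
      have tV: "a \<in> V" "t \<in> V" using c(1) w(1) less.prems(2) arcs_of_in_set[OF t] by auto
      have at: "open_img (a, t) \<subseteq> ?W" using openW t by blast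
      have atE: "(a, t) \<in> E" using t wsE by blast
      have "open_img (a, t) \<subseteq> ?I"
      proof
        fix q assume q: "q \<in> open_img (a, t)"
        then have "q \<noteq> pos a" "q \<noteq> pos b"
          using pos_not_in_open_img[OF atE] p(1) by (auto simp: is_path_def)
        then show "q \<in> ?I" using q at I(2) by blast
      qed
      then have "(a, t) \<in> inner_arcs V c" using atE tV by (simp add: inner_arcs_def)
      moreover have "(a, t) \<notin> inner_arcs V c'"
        using at open_ne[OF atE] c'(2) by (auto simp: inner_arcs_def)
      ultimately show ?thesis using c'(1) by blast
    qed
    have less1: "card (inner_arcs V c1) < card (inner_arcs V c)"
      using proper[OF sub(1) I(3)] finA by (intro psubset_card_mono) auto
    have less2: "card (inner_arcs V c2) < card (inner_arcs V c)"
      using proper[OF sub(2) I(4)] finA by (intro psubset_card_mono) auto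
    note IH1 = less.hyps[OF less1 cyc(1) cV(1)] and IH2 = less.hyps[OF less2 cyc(2) cV(2)]
    have "inner_arcs V c \<subseteq> inner_arcs V c1 \<union> inner_arcs V c2 \<union> (?ws \<union> ?ws\<inverse>)"
    proof
      fix e assume e: "e \<in> inner_arcs V c"
      obtain s t where st: "e = (s, t)" by (cases e)
      have stE: "(s, t) \<in> E" "s \<in> V" "t \<in> V" "open_img (s, t) \<subseteq> ?I" using e by (auto simp: inner_arcs_def st)
      show "e \<in> inner_arcs V c1 \<union> inner_arcs V c2 \<union> (?ws \<union> ?ws\<inverse>)"
      proof (cases "(s, t) \<in> ?ws \<union> ?ws\<inverse>")
        case True
        then show ?thesis by (simp add: st)
      next
        case False
        have "open_img (s, t) \<inter> ?W = {}"
        proof (rule ccontr)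
          assume "open_img (s, t) \<inter> ?W \<noteq> {}"
          then obtain q x y where q: "q \<in> open_img (s, t)" "(x, y) \<in> ?ws" "q \<in> img (x, y)"
            by (auto simp: path_img_def)
          have "{s, t} \<noteq> {x, y}" using False q(2) by (auto simp: doubleton_eq_iff)
          then have "\<exists>z\<in>P. q = pos z"
            using img_meet[OF stE(1) _ _ _ q(3)] q(1,2) wsE unfolding open_img_def by blast
          then show False using pos_not_in_open_img[OF stE(1)] q(1) by blast
        qed
        then have "open_img (s, t) \<subseteq> ?I1 \<union> ?I2" using stE(4) I(2) by blast
        moreover have "?I1 \<inter> ?I2 \<inter> open_img (s, t) = {}" using I(1) by blast
        moreover have "open ?I1" "open ?I2" using cyc closed_cycle_img open_inside by blast+
        ultimately have "?I1 \<inter> open_img (s, t) = {} \<or> ?I2 \<inter> open_img (s, t) = {}"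
          using connectedD[OF open_img_props(1)[OF stE(1)]] by simp
        then have "open_img (s, t) \<subseteq> ?I1 \<or> open_img (s, t) \<subseteq> ?I2"
          using \<open>open_img (s, t) \<subseteq> ?I1 \<union> ?I2\<close> by blast
        then show ?thesis using stE by (auto simp: inner_arcs_def st)
      qed
    qed
    then have "card (inner_arcs V c) \<le> card (inner_arcs V c1 \<union> inner_arcs V c2 \<union> (?ws \<union> ?ws\<inverse>))"
      using finA card_arcs_of by (intro card_mono) auto
    also have "\<dots> \<le> card (inner_arcs V c1) + card (inner_arcs V c2) + (card ?ws + card (?ws\<inverse>))"
      by (meson add_mono card_Un_le le_trans order_refl)
    also have "\<dots> \<le> card (inner_arcs V c1) + card (inner_arcs V c2) + (2 * length ws + 2)"
      using card_arcs_of[of "a # ws @ [b]"] by (simp add: card_inverse)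
    finally have arcs: "card (inner_arcs V c) \<le> card (inner_arcs V c1) + card (inner_arcs V c2) + (2 * length ws + 2)" .
    have posw: "pos x \<in> ?W - {pos a, pos b}" if "x \<in> set ws" for x
      using that p(3) pos_in_path_img_iff[of "a # ws @ [b]" x] by (auto simp: is_path_def pos_eq_iff)
    have "inner_verts V c1 \<union> inner_verts V c2 \<union> set ws \<subseteq> inner_verts V c"
      using I(2) posw w(1) by (auto simp: inner_verts_def)
    then have "card (inner_verts V c1 \<union> inner_verts V c2 \<union> set ws) \<le> card (inner_verts V c)"
      using finv by (intro card_mono)
    moreover have "inner_verts V c1 \<inter> inner_verts V c2 = {}" using I(1) by (auto simp: inner_verts_def)
    moreover have "(inner_verts V c1 \<union> inner_verts V c2) \<inter> set ws = {}"
      using posw I(3,4) unfolding inner_verts_def by blast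
    moreover have "card (set ws) = length ws" using p(3) by (simp add: is_path_def distinct_card)
    ultimately have verts: "card (inner_verts V c1) + card (inner_verts V c2) + length ws \<le> card (inner_verts V c)"
      using finv by (simp add: card_Un_disjoint)
    have "inner_quads V c1 \<union> inner_quads V c2 \<subseteq> inner_quads V c"
      using I(2) by (auto simp: inner_quads_def)
    then have "card (inner_quads V c1 \<union> inner_quads V c2) \<le> card (inner_quads V c)"
      using finQ by (intro card_mono)
    moreover have "inner_quads V c1 \<inter> inner_quads V c2 = {}"
    proof (rule ccontr)
      assume "\<not> ?thesis"
      then obtain Q where Q: "Q \<in> quads V" "inside Q \<subseteq> ?I1" "inside Q \<subseteq> ?I2" by (auto simp: inner_quads_def)
      then show False using I(1) quad_inside_nonempty[OF Q(1)] by blast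
    qed
    ultimately have quads: "card (inner_quads V c1) + card (inner_quads V c2) \<le> card (inner_quads V c)"
      using finQ by (simp add: card_Un_disjoint)
    have "length c1 = 2 + length xs + length ws" "length c2 = 2 + length ys + length ws"
      by (simp_all add: c1_def c2_def)
    then have "2 * length c1 + 2 * length c2 = 2 * length c + 4 * length ws + 4" using c(2) by simp
    \<comment> \<open>With w inner vertices on the ear, its at most 2w + 2 arcs cost 6w + 6 and its
      length, present in both cycles, adds 4w + 4. Together this is 10w + 10: the w new inner
      vertices pay 10w, and the second constant 10 pays the rest.\<close>
    then have "3 * card (inner_arcs V c1) + 3 * card (inner_arcs V c2) + 20 \<le>
        10 * card (inner_verts V c1) + 10 * card (inner_verts V c2) + 2 * length c + 4 * length ws + 4 +
        2 * card (inner_quads V c1) + 2 * card (inner_quads V c2)"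
      using IH1 IH2 by linarith
    then show ?thesis using arcs verts quads by linarith
  qed
qed

text \<open>Inseparability gives a vertex \<open>v\<close> a neighbour \<open>t\<close>; an ear
  attached to \<open>{v, t}\<close> is closed by the edge between them.\<close>

lemma exists_cycle:
  assumes "V \<subseteq> P" "\<not> separable V" "card V \<ge> 3"
  shows "\<exists>c. is_cycle c \<and> set c \<subseteq> V"
proof -
  have finV: "finite V" using assms(1) finite_P finite_subset by blast
  obtain v where v: "v \<in> V" using assms(3) by fastforce
  have "\<exists>t\<in>V. (v, t) \<in> E"
  proof (rule ccontr)
    assume no: "\<not> ?thesis"
    have "{v} \<union> (V - {v}) = V" "V - {v} \<noteq> V" "card ({v} \<inter> (V - {v})) \<le> 1" using v by auto
    moreover have "{v} \<noteq> V" using assms(3) by auto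
    moreover have "\<forall>x\<in>{v} - (V - {v}). \<forall>y\<in>(V - {v}) - {v}. (x, y) \<notin> E" using no by blast
    ultimately have "separable V" unfolding separable_def by metis
    then show False using assms(2) by simp
  qed
  then obtain t where t: "t \<in> V" "(v, t) \<in> E" by blast
  then have vt: "v \<noteq> t" using E_verts by blast
  have "\<not> V \<subseteq> {v, t}"
    using assms(3) vt card_mono[of "{v, t}" V] by auto
  then obtain z where z: "z \<in> V - {v, t}" by blast
  from exists_ear[OF finV assms(2), of "{v, t}" z] v t vt z
  obtain a ws b where ear: "a \<in> {v, t}" "b \<in> {v, t}" "ws \<noteq> []" "distinct (a # ws @ [b])"
    "arcs_of (a # ws @ [b]) \<subseteq> E" "set ws \<subseteq> V - {v, t}" by auto
  have "(a = v \<and> b = t) \<or> (a = t \<and> b = v)" using ear(1,2,4) by auto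
  then have ab: "(b, a) \<in> E" using t(2) E_sym[OF t(2)] by auto
  have "is_path (a # ws @ [b])" "is_path (a # [] @ [b])"
    using ear(1,2,4,5,6) assms(1) v t E_sym[OF ab] by (auto simp: is_path_def)
  from cycle_join(1)[OF this] ear(3) have "is_cycle (a # ws @ b # rev [])" by simp
  moreover have "set (a # ws @ b # rev []) \<subseteq> V" using ear(1,2,6) v t by auto
  ultimately show ?thesis by blast
qed

text \<open>The outer boundary, obtained as a cycle whose inside is maximal among finitely many. An
  edge outside would yield an ear outside, and by \<open>theta_curve_inside\<close> one of the two
  cycles through that ear encloses strictly more.\<close>

lemma exists_outer_cycle:
  assumes V: "V \<subseteq> P" "\<not> separable V" "card V \<ge> 3"
  shows "\<exists>c. is_cycle c \<and> set c \<subseteq> V \<and>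
    (\<forall>(u, v)\<in>E \<inter> V \<times> V. \<not> open_img (u, v) \<subseteq> outside (cycle_img c))"
proof -
  define S where "S = (\<lambda>c. inside (cycle_img c)) ` {c. is_cycle c \<and> set c \<subseteq> V}"
  obtain c0 where "is_cycle c0 \<and> set c0 \<subseteq> V" using exists_cycle[OF V] by blast
  then have "finite S" "S \<noteq> {}" using finite_cycles[OF V(1)] by (auto simp: S_def)
  from finite_has_maximal[OF this] obtain M where M: "M \<in> S" "\<forall>N\<in>S. M \<subseteq> N \<longrightarrow> M = N" by (rule bexE)
  then obtain c where c: "is_cycle c" "set c \<subseteq> V" "M = inside (cycle_img c)" by (auto simp: S_def)
  have "\<not> open_img (u, v) \<subseteq> outside (cycle_img c)" if uv: "(u, v) \<in> E" "u \<in> V" "v \<in> V" for u v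
  proof
    assume out: "open_img (u, v) \<subseteq> outside (cycle_img c)"
    have "side_of (outside (cycle_img c)) c" using c by (simp add: side_of_def)
    from ear_theta[OF V(1,2) c(2) this uv out]
    obtain a b xs ys ws where p: "is_path (a # xs @ [b])" "is_path (a # ys @ [b])" "is_path (a # ws @ [b])"
      and d: "set xs \<inter> set ys = {}" "set xs \<inter> set ws = {}" "set ys \<inter> set ws = {}"
      and ne: "xs \<noteq> [] \<or> ys \<noteq> []" "xs \<noteq> [] \<or> ws \<noteq> []" "ys \<noteq> [] \<or> ws \<noteq> []"
      and sc: "set c = {a, b} \<union> set xs \<union> set ys" and lc: "length c = 2 + length xs + length ys"
      and ci: "cycle_img c = path_img (a # xs @ [b]) \<union> path_img (a # ys @ [b])"
      and w: "set ws \<subseteq> V - set c" "path_img (a # ws @ [b]) \<subseteq> outside (cycle_img c) \<union> {pos a, pos b}" .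
    let ?X = "path_img (a # xs @ [b])" and ?Y = "path_img (a # ys @ [b])" and ?W = "path_img (a # ws @ [b])"
    obtain g1 where g1: "arc g1" "pathstart g1 = pos a" "pathfinish g1 = pos b" "path_image g1 = ?X"
      using path_arc[OF p(1)] by auto
    obtain g2 where g2: "arc g2" "pathstart g2 = pos a" "pathfinish g2 = pos b" "path_image g2 = ?Y"
      using path_arc[OF p(2)] by auto
    obtain g3 where g3: "arc g3" "pathstart g3 = pos a" "pathfinish g3 = pos b" "path_image g3 = ?W"
      using path_arc[OF p(3)] by auto
    have meets: "?X \<inter> ?Y = {pos a, pos b}" "?X \<inter> ?W = {pos a, pos b}" "?Y \<inter> ?W = {pos a, pos b}"
      using disjoint_paths_meet[OF p(1,2) d(1) ne(1)] disjoint_paths_meet[OF p(1,3) d(2) ne(2)]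
        disjoint_paths_meet[OF p(2,3) d(3) ne(3)] by simp_all
    have "pos a \<in> cycle_img c" "pos b \<in> cycle_img c" using meets(1) ci by auto
    then have "?W \<inter> inside (?X \<union> ?Y) = {}"
      using w(2) inside_no_overlap[of "cycle_img c"] inside_Int_outside[of "cycle_img c"]
      unfolding ci by blast
    then have theta: "inside (?X \<union> ?Y) \<union> (?Y - {pos a, pos b}) \<subseteq> inside (?X \<union> ?W) \<or>
        inside (?X \<union> ?Y) \<union> (?X - {pos a, pos b}) \<subseteq> inside (?Y \<union> ?W)"
      using theta_curve_inside[OF g1(1-3) g2(1-3) g3(1-3)] meets unfolding g1(4) g2(4) g3(4) by blast
    have no: False if "is_path (a # zs @ [b])" "is_path (a # zs' @ [b])" "set zs \<inter> set ws = {}" "zs \<noteq> [] \<or> ws \<noteq> []"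
      "set zs \<subseteq> set c" "path_img (a # zs' @ [b]) \<subseteq> cycle_img c"
      "inside (cycle_img c) \<union> (path_img (a # zs' @ [b]) - {pos a, pos b}) \<subseteq> inside (path_img (a # zs @ [b]) \<union> ?W)"
      for zs zs'
    proof -
      let ?c = "a # zs @ b # rev ws"
      have "is_cycle ?c" "cycle_img ?c = path_img (a # zs @ [b]) \<union> ?W"
        using cycle_join[OF that(1) p(3) that(3,4)] by simp_all
      moreover have "set ?c \<subseteq> V" using that(5) w(1) sc c(2) by auto
      ultimately have "inside (path_img (a # zs @ [b]) \<union> ?W) \<in> S"
        unfolding S_def by (intro image_eqI[of _ _ ?c]) simp_all
      \<comment> \<open>Maximality turns the inclusion into an equality. The replaced half of
        \<open>c\<close> would then have points inside the very curve it belongs to.\<close>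
      then have "inside (cycle_img c) = inside (path_img (a # zs @ [b]) \<union> ?W)"
        using that(7) c(3) M(2) by blast
      then have "path_img (a # zs' @ [b]) - {pos a, pos b} \<subseteq> inside (cycle_img c)" using that(7) by blast
      then show False
        using path_ends_removed[OF that(2)] that(6) inside_no_overlap[of "cycle_img c"] by blast
    qed
    show False
      using theta no[OF p(1,2) d(2) ne(2)] no[OF p(2,1) d(3) ne(3)] sc unfolding ci by auto
  qed
  then show ?thesis using c by (intro exI[of _ c]) auto
qed

lemma card_quads:
  assumes "V \<subseteq> P"
    and dj: "\<And>d d'. is_cycle d \<Longrightarrow> is_cycle d' \<Longrightarrow> length d = 4 \<Longrightarrow> length d' = 4 \<Longrightarrow>
      cycle_img d \<noteq> cycle_img d' \<Longrightarrow> set d \<inter> set d' = {}"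
  shows "4 * card (quads V) \<le> card V"
proof -
  have finV: "finite V" using assms(1) finite_P finite_subset by blast
  \<comment> \<open>Recovers the vertices of a cycle from its point set alone, as the elements of
    \<open>quads V\<close> no longer carry a list.\<close>
  define f where "f Q = {v \<in> V. pos v \<in> Q}" for Q
  have f: "f (cycle_img d) = set d" if "is_cycle d" "set d \<subseteq> V" for d
    using that pos_in_cycle_img_iff[OF that(1)] assms(1) unfolding f_def by blast
  have "f Q \<inter> f Q' = {}" if "Q \<in> quads V" "Q' \<in> quads V" "Q \<noteq> Q'" for Q Q'
    using that f dj unfolding quads_def by (smt (verit) mem_Collect_eq)
  then have "card (\<Union>Q\<in>quads V. f Q) = (\<Sum>Q\<in>quads V. card (f Q))"
    using finite_quads[OF assms(1)] finV by (intro card_UN_disjoint) (auto simp: f_def)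
  also have "\<dots> = (\<Sum>Q\<in>quads V. 4)"
  proof (rule sum.cong)
    fix Q assume "Q \<in> quads V"
    then obtain d where "is_cycle d" "length d = 4" "set d \<subseteq> V" "Q = cycle_img d" by (auto simp: quads_def)
    then show "card (f Q) = 4" using f distinct_card[of d] by (auto simp: is_cycle_def)
  qed simp
  finally have "4 * card (quads V) = card (\<Union>Q\<in>quads V. f Q)" by simp
  also have "\<dots> \<le> card V" using finV by (intro card_mono) (auto simp: f_def)
  finally show ?thesis .
qed

text \<open>The additive constant is chosen so that the bound survives gluing at a cut vertex.\<close>
theorem planar_arcs_bound:
  assumes no3: "\<And>d. is_cycle d \<Longrightarrow> length d \<noteq> 3"
    and dj: "\<And>d d'. is_cycle d \<Longrightarrow> is_cycle d' \<Longrightarrow> length d = 4 \<Longrightarrow> length d' = 4 \<Longrightarrow>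
      cycle_img d \<noteq> cycle_img d' \<Longrightarrow> set d \<inter> set d' = {}"
    and "V \<subseteq> P" "V \<noteq> {}"
  shows "6 * arcs_in V + 21 \<le> 21 * card V"
  using assms(3,4)
proof (induction "card V" arbitrary: V rule: less_induct)
  case less
  have finV: "finite V" using less.prems(1) finite_P finite_subset by blast
  consider "separable V" | "\<not> separable V" "card V \<le> 2" | "\<not> separable V" "card V \<ge> 3" by linarith
  then show ?case
  proof cases
    case 1
    then obtain V1 V2 where V12: "V1 \<union> V2 = V" "V1 \<noteq> V" "V2 \<noteq> V" "card (V1 \<inter> V2) \<le> 1"
      and sep: "\<forall>x\<in>V1 - V2. \<forall>y\<in>V2 - V1. (x, y) \<notin> E" unfolding separable_def by blast
    have fin: "finite V1" "finite V2" using V12(1) finV by auto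
    have sub: "V1 \<subset> V" "V2 \<subset> V" "V1 \<noteq> {}" "V2 \<noteq> {}" using V12 by auto
    have IH1: "6 * arcs_in V1 + 21 \<le> 21 * card V1"
      using sub less.prems psubset_card_mono[OF finV sub(1)] by (intro less.hyps) auto
    have IH2: "6 * arcs_in V2 + 21 \<le> 21 * card V2"
      using sub less.prems psubset_card_mono[OF finV sub(2)] by (intro less.hyps) auto
    have "E \<inter> V \<times> V \<subseteq> (E \<inter> V1 \<times> V1) \<union> (E \<inter> V2 \<times> V2)"
    proof
      fix e assume e: "e \<in> E \<inter> V \<times> V"
      obtain x y where xy: "e = (x, y)" by (cases e)
      have "(x, y) \<in> E" "(y, x) \<in> E" using e E_sym xy by auto
      then show "e \<in> (E \<inter> V1 \<times> V1) \<union> (E \<inter> V2 \<times> V2)" using e sep V12(1) unfolding xy by blast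
    qed
    then have "arcs_in V \<le> card ((E \<inter> V1 \<times> V1) \<union> (E \<inter> V2 \<times> V2))"
      unfolding arcs_in_def using fin by (intro card_mono) auto
    also have "\<dots> \<le> arcs_in V1 + arcs_in V2" unfolding arcs_in_def by (rule card_Un_le)
    finally have "arcs_in V \<le> arcs_in V1 + arcs_in V2" .
    moreover have "card V1 + card V2 = card V + card (V1 \<inter> V2)"
      using card_Un_Int[OF fin] V12(1) by simp
    ultimately show ?thesis using IH1 IH2 V12(4) by linarith
  next
    case 2
    have "card V \<noteq> 0" using less.prems(2) finV by simp
    then consider "card V = 1" | "card V = 2" using 2 by linarith
    then show ?thesis
    proof cases
      case 1
      then obtain x where "V = {x}" by (auto simp: card_1_singleton_iff)
      then have "E \<inter> V \<times> V = {}" using E_irrefl by auto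
      then show ?thesis using 1 by (simp add: arcs_in_def)
    next
      case 2
      then obtain x y where "V = {x, y}" by (auto simp: card_2_iff)
      then have "E \<inter> V \<times> V \<subseteq> {(x, y), (y, x)}" using E_irrefl by auto
      then have "arcs_in V \<le> card {(x, y), (y, x)}" unfolding arcs_in_def by (intro card_mono) auto
      also have "\<dots> \<le> 2" using card_length[of "[(x, y), (y, x)]"] by simp
      finally show ?thesis using 2 by simp
    qed
  next
    case 3
    obtain c where c: "is_cycle c" "set c \<subseteq> V"
      and out: "\<And>u v. (u, v) \<in> E \<Longrightarrow> u \<in> V \<Longrightarrow> v \<in> V \<Longrightarrow> \<not> open_img (u, v) \<subseteq> outside (cycle_img c)"
      using exists_outer_cycle[OF less.prems(1) 3] by blast
    let ?C = "arcs_of (c @ [hd c])"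
    have "E \<inter> V \<times> V \<subseteq> inner_arcs V c \<union> (?C \<union> ?C\<inverse>)"
    proof
      fix e assume e: "e \<in> E \<inter> V \<times> V"
      obtain u v where uv: "e = (u, v)" by (cases e)
      have uvE: "(u, v) \<in> E" "u \<in> V" "v \<in> V" using e uv by auto
      show "e \<in> inner_arcs V c \<union> (?C \<union> ?C\<inverse>)"
      proof (cases "(u, v) \<in> ?C \<union> ?C\<inverse>")
        case True
        then show ?thesis by (simp add: uv)
      next
        case False
        have ne: "{u, v} \<noteq> {x, y}" if "(x, y) \<in> ?C" for x y
          using False that by (auto simp: doubleton_eq_iff)
        have "open_img (u, v) \<inter> cycle_img c = {}"
        proof (rule ccontr)
          assume "open_img (u, v) \<inter> cycle_img c \<noteq> {}"
          then obtain q where q: "q \<in> open_img (u, v)" "q \<in> cycle_img c" by blast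
          then have "q \<in> img (u, v)" by (simp add: open_img_def)
          from arc_meets_cycle[OF c(1) uvE(1) ne this q(2)] obtain w where "w \<in> {u, v}" "q = pos w" by blast
          then show False using q(1) by (auto simp: open_img_def)
        qed
        then have "open_img (u, v) \<subseteq> inside (cycle_img c)"
          using connected_inside_or_outside[OF closed_cycle_img[OF c(1)] open_img_props(1)[OF uvE(1)]]
            out[OF uvE] by blast
        then show ?thesis using uvE by (simp add: inner_arcs_def uv)
      qed
    qed
    then have "arcs_in V \<le> card (inner_arcs V c \<union> (?C \<union> ?C\<inverse>))"
      unfolding arcs_in_def using finV card_arcs_of[of "c @ [hd c]"]
      by (intro card_mono) (auto simp: inner_arcs_def)
    also have "\<dots> \<le> card (inner_arcs V c) + (card ?C + card (?C\<inverse>))"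
      by (meson add_mono card_Un_le le_trans order_refl)
    also have "\<dots> \<le> card (inner_arcs V c) + 2 * length c"
      using card_arcs_of[of "c @ [hd c]"] by (simp add: card_inverse)
    finally have arcs: "arcs_in V \<le> card (inner_arcs V c) + 2 * length c" .
    have "set c \<inter> inner_verts V c = {}"
    proof (rule ccontr)
      assume "\<not> ?thesis"
      then obtain w where w: "w \<in> set c" "pos w \<in> inside (cycle_img c)" by (auto simp: inner_verts_def)
      have "w \<in> P" using w(1) c(2) less.prems(1) by blast
      then have "pos w \<in> cycle_img c" using w(1) pos_in_cycle_img_iff[OF c(1)] by blast
      then show False using w(2) inside_no_overlap[of "cycle_img c"] by blast
    qed
    then have "card (set c) + card (inner_verts V c) = card (set c \<union> inner_verts V c)"
      using finV by (subst card_Un_disjoint) (auto simp: inner_verts_def)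
    also have "\<dots> \<le> card V" using finV c(2) by (intro card_mono) (auto simp: inner_verts_def)
    finally have verts: "length c + card (inner_verts V c) \<le> card V"
      using c(1) by (simp add: is_cycle_def distinct_card)
    have "card (inner_quads V c) \<le> card (quads V)"
      using finite_quads[OF less.prems(1)] by (intro card_mono) (auto simp: inner_quads_def)
    moreover have "4 * card (quads V) \<le> card V"
      using less.prems(1) dj by (intro card_quads)
    moreover have "3 * card (inner_arcs V c) + 10 \<le> 10 * card (inner_verts V c) + 2 * length c + 2 * card (inner_quads V c)"
      using less.prems(1) 3(1) no3 c by (intro disc_bound)
    moreover have "length c \<ge> 3" using c(1) by (simp add: is_cycle_def)
    \<comment> \<open>With n = \<open>card V\<close> and l = \<open>length c\<close>, the estimates
      add up to \<open>6 * arcs_in V\<close> being at most 20(n - l) + 4l + n - 20 + 12l = 21n - 4l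
      - 20, where the single n stands for the quadrilaterals; then l is at least 3.\<close>
    ultimately show ?thesis using arcs verts by linarith
  qed
qed

end

section \<open>Planar graphs without intersecting 4-cycles\<close>

fun colorings_of :: "('a \<Rightarrow> 'c) \<Rightarrow> ('a \<times> 'c) list \<Rightarrow> ('a \<Rightarrow> 'c) list" where
  "colorings_of f [] = [f]"
| "colorings_of f ((v, c) # ms) = f # colorings_of (f(v := c)) ms"

lemma colorings_of_not_Nil [simp]: "colorings_of f ms \<noteq> []"
  by (induction f ms rule: colorings_of.induct) auto

lemma hd_colorings_of [simp]: "hd (colorings_of f ms) = f"
  by (induction f ms rule: colorings_of.induct) auto

lemma times_recolored_Cons:
  assumes "cs \<noteq> []"
  shows "times_recolored (f # cs) v = (if f v \<noteq> hd cs v then 1 else 0) + times_recolored cs v"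
proof -
  let ?A = "\<lambda>cs. {i. Suc i < length cs \<and> (cs ! i) v \<noteq> (cs ! Suc i) v}"
  have eq: "?A (f # cs) = (if f v \<noteq> hd cs v then {0} else {}) \<union> Suc ` ?A cs"
  proof (rule set_eqI)
    fix i
    show "i \<in> ?A (f # cs) \<longleftrightarrow> i \<in> (if f v \<noteq> hd cs v then {0} else {}) \<union> Suc ` ?A cs"
      using assms by (cases i) (auto simp: hd_conv_nth)
  qed
  have fin: "finite (Suc ` ?A cs)"
    by (intro finite_imageI, rule finite_subset[of _ "{..<length cs}"]) auto
  have "card (Suc ` ?A cs) = card (?A cs)" by (rule card_image) simp
  then show ?thesis
    unfolding times_recolored_def eq using fin by (subst card_Un_disjoint) auto
qed

lemma times_recolored_singleton [simp]: "times_recolored [f] v = 0"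
  by (simp add: times_recolored_def)

context list_graph
begin

lemma times_recolored_colorings_of: "valid V f ms \<Longrightarrow> times_recolored (colorings_of f ms) v = recolorings ms v"
proof (induction ms arbitrary: f)
  case (Cons m ms)
  obtain u c where m: "m = (u, c)" by (cases m)
  have c: "c \<noteq> f u" and vld: "valid V (f(u := c)) ms" using Cons.prems by (simp_all add: m)
  have "times_recolored (colorings_of (f(u := c)) ms) v = recolorings ms v" using vld by (rule Cons.IH)
  then show ?case using c by (auto simp: m times_recolored_Cons)
qed simp

lemma recoloring_sequence_colorings_of:
  assumes "pverts G = V" "parcs G = E" "E \<subseteq> V \<times> V" "valid V f ms" "f \<in> extensional V"
  shows "recoloring_sequence G L f (run f ms) (colorings_of f ms)"
proof -
  have col: "list_coloring G L g" if "coloring V g" "g \<in> extensional V" for g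
    using that assms(1-3) by (auto simp: list_coloring_def coloring_def PiE_def)
  show ?thesis using assms(4,5)
  proof (induction ms arbitrary: f)
    case Nil
    then show ?case using col by (simp add: recoloring_sequence_def)
  next
    case (Cons m ms)
    obtain u c where m: "m = (u, c)" by (cases m)
    let ?g = "f(u := c)"
    have u: "c \<noteq> f u" "u \<in> V" "valid V ?g ms" and f: "coloring V f" using Cons.prems by (simp_all add: m)
    have "?g \<in> extensional V" using Cons.prems(2) u(2) by (auto simp: extensional_def)
    then have IH: "recoloring_sequence G L ?g (run ?g ms) (colorings_of ?g ms)" using Cons.IH u(3) by blast
    have "\<exists>!v. v \<in> pverts G \<and> f v \<noteq> ?g v" using u assms(1) by (intro ex1I[of _ u]) (auto split: if_splits)
    moreover have "colorings_of ?g ms ! 0 = ?g" using hd_conv_nth[of "colorings_of ?g ms"] by simp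
    ultimately have "\<exists>!v. v \<in> pverts G \<and> ((f # colorings_of ?g ms) ! i) v \<noteq> ((f # colorings_of ?g ms) ! Suc i) v"
      if "Suc i < length (f # colorings_of ?g ms)" for i
      using that IH by (cases i) (simp_all add: recoloring_sequence_def)
    then show ?case
      using IH col[OF f Cons.prems(2)] unfolding recoloring_sequence_def by (simp add: m)
  qed
qed

end

text \<open>Only lengths 3 and 4 occur in the hypotheses on the graph, so the closed walks are
  written out explicitly.\<close>

lemma k_cycle_of_cyclic_list:
  assumes "length c = 3 \<or> length c = 4" "distinct c" "set c \<subseteq> pverts G"
    "arcs_of (c @ [hd c]) \<subseteq> parcs G"
  shows "\<exists>p. k_cycle (length c) G p \<and> set p = arcs_of (c @ [hd c])"
proof -
  from assms(1) consider x y z where "c = [x, y, z]" | x y z w where "c = [x, y, z, w]"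
    by (auto simp: eval_nat_numeral length_Suc_conv)
  then show ?thesis
  proof cases
    case 1
    then show ?thesis
      using assms(2-)
      by (intro exI[of _ "[(x, y), (y, z), (z, x)]"])
        (auto simp: k_cycle_def pre_digraph.cycle_def pre_digraph.awalk_def cas_with_proj_eq
          awalk_verts_with_proj_eq intro!: exI[of _ x])
  next
    case 2
    then show ?thesis
      using assms(2-)
      by (intro exI[of _ "[(x, y), (y, z), (z, w), (w, x)]"])
        (auto simp: k_cycle_def pre_digraph.cycle_def pre_digraph.awalk_def cas_with_proj_eq
          awalk_verts_with_proj_eq intro!: exI[of _ x])
  qed
qed

lemma plane_graph_of_drawing:
  assumes "pair_graph G" "plane_drawing G pos crv"
  shows "plane_graph (parcs G) (pverts G) pos crv"
proof -
  have dr: "arc (crv (u, v))" "pathstart (crv (u, v)) = pos u" "pathfinish (crv (u, v)) = pos v"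
    "path_image (crv (u, v)) \<inter> pos ` pverts G = {pos u, pos v}" "crv (v, u) = reversepath (crv (u, v))"
    if "(u, v) \<in> parcs G" for u v
    using assms(2) that unfolding plane_drawing_def by blast+
  have meet: "path_image (crv (u, v)) \<inter> path_image (crv (x, y)) \<subseteq> pos ` pverts G"
    if "(u, v) \<in> parcs G" "(x, y) \<in> parcs G" "{u, v} \<noteq> {x, y}" for u v x y
    using assms(2) that unfolding plane_drawing_def by blast
  interpret pair_graph G by fact
  have sym: "sym (parcs G)" using pair_sym_arcs by (simp add: symmetric_def)
  show ?thesis
  proof unfold_locales
    show "(v, u) \<in> parcs G" if "(u, v) \<in> parcs G" for u v using sym that by (rule symD)
    show "(v, v) \<notin> parcs G" for v using pair_no_loops[of "(v, v)"] by auto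
    show "finite (pverts G)" by (rule pair_finite_verts)
    show "parcs G \<subseteq> pverts G \<times> pverts G" using in_arcsD1 in_arcsD2 by auto
    show "inj_on pos (pverts G)" using assms(2) by (simp add: plane_drawing_def)
  qed (fact dr meet)+
qed

theorem theorem1p3:
  fixes G :: "'a pair_pre_digraph"
    and L :: "'a \<Rightarrow> 'c set"
    and \<alpha> \<beta> :: "'a \<Rightarrow> 'c"
  assumes "pair_graph G"
    and "planar_graph G"
    and "no_3_cycles G"
    and "no_intersecting_4_cycles G"
    and "list_assignment 6 G L"
    and "list_coloring G L \<alpha>"
    and "list_coloring G L \<beta>"
  shows "\<exists>cs. recoloring_sequence G L \<alpha> \<beta> cs \<and>
           (\<forall>v \<in> pverts G. times_recolored cs v \<le> 48)"
proof -
  let ?V = "pverts G" and ?E = "parcs G"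
  obtain pos crv where "plane_drawing G pos crv" using assms(2) by (auto simp: planar_graph_def)
  then interpret plane_graph ?E ?V pos crv by (rule plane_graph_of_drawing[OF assms(1)])
  interpret list_graph ?E L by unfold_locales
  have k_cycle: "\<exists>p. k_cycle (length d) G p \<and> set p = arcs_of (d @ [hd d])"
    if "is_cycle d" "length d = 3 \<or> length d = 4" for d
    using that by (intro k_cycle_of_cyclic_list) (auto simp: is_cycle_def)
  have no3: "length d \<noteq> 3" if "is_cycle d" for d
    using k_cycle[OF that] assms(3) unfolding no_3_cycles_def by metis
  have dj: "set d \<inter> set d' = {}"
    if d: "is_cycle d" "is_cycle d'" "length d = 4" "length d' = 4" and ne: "cycle_img d \<noteq> cycle_img d'" for d d'
  proof -
    obtain p where p: "k_cycle 4 G p" "set p = arcs_of (d @ [hd d])" using k_cycle[OF d(1)] d(3) by metis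
    obtain q where q: "k_cycle 4 G q" "set q = arcs_of (d' @ [hd d'])" using k_cycle[OF d(2)] d(4) by metis
    \<comment> \<open>The point set of a cycle is determined by its undirected edges, so cycles with
      different point sets are distinct as subgraphs and the disjointness hypothesis applies to
      them.\<close>
    have img: "cycle_img c = \<Union> {S. \<exists>u v. {u, v} \<in> cycle_edges r \<and> (u, v) \<in> ?E \<and> S = img (u, v)}"
      if "is_cycle c" "set r = arcs_of (c @ [hd c])" for c r
    proof -
      have sub: "arcs_of (c @ [hd c]) \<subseteq> ?E" using that(1) by (simp add: is_cycle_def)
      have "img (u, v) \<subseteq> cycle_img c" if "{u, v} \<in> cycle_edges r" "(u, v) \<in> ?E" for u v
      proof -
        have "{u, v} \<in> (\<lambda>(x, y). {x, y}) ` arcs_of (c @ [hd c])"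
          using that(1) unfolding cycle_edges_def \<open>set r = arcs_of (c @ [hd c])\<close> .
        then obtain x y where xy: "(x, y) \<in> arcs_of (c @ [hd c])" "{u, v} = {x, y}" by fast
        have "(x, y) \<in> ?E" using xy(1) sub by blast
        then have "img (u, v) = img (x, y)" using xy(2) img_commute[of x y] by (auto simp: doubleton_eq_iff)
        then show ?thesis using xy(1) by (auto simp: cycle_img_def path_img_def)
      qed
      moreover have "\<exists>u v. {u, v} \<in> cycle_edges r \<and> (u, v) \<in> ?E \<and> p \<in> img (u, v)" if "p \<in> cycle_img c" for p
      proof -
        obtain x y where xy: "(x, y) \<in> arcs_of (c @ [hd c])" "p \<in> img (x, y)"
          using \<open>p \<in> cycle_img c\<close> by (auto simp: cycle_img_def path_img_def)
        then have "{x, y} \<in> cycle_edges r"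
          unfolding cycle_edges_def \<open>set r = arcs_of (c @ [hd c])\<close> by (intro image_eqI[of _ _ "(x, y)"]) simp_all
        then show ?thesis using xy sub by blast
      qed
      ultimately show ?thesis by (intro equalityI subsetI) blast+
    qed
    have "cycle_edges p \<noteq> cycle_edges q" using img[OF d(1) p(2)] img[OF d(2) q(2)] ne by metis
    then have "cycle_verts p \<inter> cycle_verts q = {}"
      using assms(4) p(1) q(1) unfolding no_intersecting_4_cycles_def by blast
    moreover have "set c = cycle_verts r" if c: "is_cycle c" "length c = 4" "set r = arcs_of (c @ [hd c])" for c r
    proof -
      obtain x y z w where "c = [x, y, z, w]" using c(2) by (auto simp: eval_nat_numeral length_Suc_conv)
      then show ?thesis unfolding cycle_verts_def c(3) by auto
    qed
    ultimately show ?thesis using d p(2) q(2) by metis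
  qed
  have "recolorable ?V (\<lambda>_. 48)"
  proof (rule sparse_recolorable)
    show "finite ?V" by (rule finite_P)
    show "6 \<le> card (L v)" if "v \<in> ?V" for v using assms(5) that by (simp add: list_assignment_def)
    show "2 * arcs_in W < 7 * card W" if "W \<subseteq> ?V" "W \<noteq> {}" for W
      using planar_arcs_bound[OF no3 dj that] by linarith
  qed
  moreover have col: "coloring ?V f" "f \<in> extensional ?V" if "list_coloring G L f" for f
    using that by (auto simp: list_coloring_def coloring_def PiE_def)
  ultimately obtain ms where ms: "valid ?V \<alpha> ms" "\<forall>v\<in>?V. run \<alpha> ms v = \<beta> v" "\<forall>v\<in>?V. recolorings ms v \<le> 48"
    using assms(6,7) unfolding recolorable_def by blast
  have seq: "recoloring_sequence G L \<alpha> (run \<alpha> ms) (colorings_of \<alpha> ms)"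
    using E_P ms(1) col(2)[OF assms(6)] by (intro recoloring_sequence_colorings_of) auto
  then have "list_coloring G L (run \<alpha> ms)"
    unfolding recoloring_sequence_def by (metis last_in_set)
  \<comment> \<open>The moves yield agreement on the vertices only; both colorings are extensional,
    so they are equal as functions.\<close>
  then have "run \<alpha> ms = \<beta>"
    using col(2) assms(7) ms(2) by (intro extensionalityI[of _ ?V]) auto
  then show ?thesis
    using seq ms(1,3) times_recolored_colorings_of by (intro exI[of _ "colorings_of \<alpha> ms"]) simp
qed

end
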